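(* Let $f:\mathbb{R}^N\to\mathbb{R}\cup\{+\infty\}$ be a proper closed convex function, $A\in\mathbb{R}^{M\times N}$, $\bm{b}\in\mathbb{R}^M$, and let $G$, $F$, $\ell$ be the functions associated with $(f,A,\bm{b})$ defined in the context. Let $\rho\in[0,1)$, let $\{\sigma_k\}_{k\ge 0}$ be a positive sequence satisfying $\sigma_k\ge\sigma_{\min}>0$ for all $k\ge0$, and let $\{\tau_k\}_{k\ge0}$ be a positive sequence satisfying $$\tau_k\ge\tau_{\min}>0,\qquad \tau_{k+1}\le(1+\nu_k)\tau_k\quad\text{with}\quad \nu_k\ge0\ \text{ and }\ \sum_{k=0}^\infty\nu_k<+\infty .$$ Let $\{\bm{y}^k\},\{\Delta^k\},\{\bm{w}^k\}\subset\mathbb{R}^M$ and $\{\bm{x}^k\}\subset\mathbb{R}^N$ be sequences generated by the algorithm ripALM (described in the context) with these parameters, from arbitrary starting points $\bm{y}^0,\bm{w}^0\in\mathbb{R}^M$, $\bm{x}^0\in\mathbb{R}^N$. If $\ell$ admits a saddle point (i.e., $(\partial\ell)^{-1}(\bm{0},\bm{0})\ne\emptyset$), then the following statements hold. (i) The sequences $\{\bm{y}^k\}$, $\{\bm{w}^k\}$ and $\{\bm{x}^k\}$ are bounded. (ii) $\lim_{k\to\infty}\Delta^{k+1}=\bm{0}$, $\lim_{k\to\infty}\bm{\theta}^{k+1}=\bm{0}$ and $\lim_{k\to\infty}\bm{\xi}^{k+1}=\bm{0}$, where for all $k\ge0$ $$\bm{\theta}^{k+1}:=\Delta^{k+1}-\tau_k\sigma_k^{-1}(\bm{y}^{k+1}-\bm{y}^k),\qquad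 \bm{\xi}^{k+1}:=\sigma_k^{-1}(\bm{x}^k-\bm{x}^{k+1}).$$ (iii) Both sequences $\{G(\bm{y}^{k+1},\bm{\xi}^{k+1})\}$ and $\{F(\bm{\theta}^{k+1},\bm{x}^{k+1})\}$ converge to the common optimal value of the problems $\min_{\bm{y}\in\mathbb{R}^M}G(\bm{y},\bm{0})$ and $\max_{\bm{x}\in\mathbb{R}^N}F(\bm{0},\bm{x})$. (iv) Any accumulation point of $\{\bm{y}^k\}$ is an optimal solution of $\min_{\bm{y}\in\mathbb{R}^M}G(\bm{y},\bm{0})$ (i.e., of $\min_{\bm{y}}\, f^*(A^\top\bm{y})-\bm{b}^\top\bm{y}$), and any accumulation point of $\{\bm{x}^k\}$ is an optimal solution of $\max_{\bm{x}\in\mathbb{R}^N}F(\bm{0},\bm{x})$ (i.e., of $\min_{\bm{x}}\{f(\bm{x}): A\bm{x}=\bm{b}\}$). (v) The sequence $\{\bm{x}^k\}$ converges to an optimal solution of $\max_{\bm{x}\in\mathbb{R}^N}F(\bm{0},\bm{x})$.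
   Context: Notation. $\|\cdot\|$ is the Euclidean norm. For a proper closed convex $f$: $f^*(\bm{z})=\sup_{\bm{x}}\{\langle\bm{z},\bm{x}\rangle-f(\bm{x})\}$ is the convex conjugate, $\partial f$ the convex subdifferential, and for $\nu>0$, $\mathtt{prox}_{\nu f}(\bm{x}):=\arg\min_{\bm{z}}\{f(\bm{z})+\frac{1}{2\nu}\|\bm{z}-\bm{x}\|^2\}$ and $\mathtt{M}_{\nu f}(\bm{x}):=\min_{\bm{z}}\{f(\bm{z})+\frac{1}{2\nu}\|\bm{z}-\bm{x}\|^2\}$. Functions. Define $G:\mathbb{R}^M\times\mathbb{R}^N\to(-\infty,+\infty]$ by $$G(\bm{y},\bm{\xi}):=f^*(A^\top\bm{y}+\bm{\xi})-\bm{b}^\top\bm{y},$$ its concave conjugate $F$ on $\mathbb{R}^M\times\mathbb{R}^N$ (with values in $[-\infty,+\infty)$) by $$F(\bm{\theta},\bm{x}):=\inf_{\bm{y}\in\mathbb{R}^M,\,\bm{\xi}\in\mathbb{R}^N}\{G(\bm{y},\bm{\xi})-\langle\bm{\theta},\bm{y}\rangle-\langle\bm{x},\bm{\xi}\rangle\},$$ and the Lagrangian $$\ell(\bm{y},\bm{x}):=\inf_{\bm{\xi}\in\mathbb{R}^N}\{G(\bm{y},\bm{\xi})-\langle\bm{x},\bm{\xi}\rangle\}=-\bm{b}^\top\bm{y}+\langle\bm{x},A^\top\bm{y}\rangle-f(\bm{x}).$$ Its subgradient map is $$\partial\ell(\bm{y},\bm{x})=\{A\bm{x}-\bm{b}\}\times\{\bm{v}-A^\top\bm{y}\mid\bm{v}\in\partial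 f(\bm{x})\}.$$ $(\partial\ell)^{-1}(\bm{0},\bm{0})$ is the set of $(\bm{y},\bm{x})$ with $(\bm{0},\bm{0})\in\partial\ell(\bm{y},\bm{x})$; its elements are called saddle points of $\ell$. Augmented Lagrangian. For $\sigma>0$, $$\mathcal{L}_\sigma(\bm{y},\bm{x}):=-\bm{b}^\top\bm{y}+\frac{1}{2\sigma}\|\bm{x}+\sigma A^\top\bm{y}\|^2-\frac{1}{2\sigma}\|\bm{x}\|^2-\mathtt{M}_{\sigma f}(\bm{x}+\sigma A^\top\bm{y}),$$ which is continuously differentiable in $\bm{y}$ with $\nabla_y\mathcal{L}_\sigma(\bm{y},\bm{x})=A\,\mathtt{prox}_{\sigma f}(\bm{x}+\sigma A^\top\bm{y})-\bm{b}$. Algorithm ripALM. Given $\rho\in[0,1)$, positive sequences $\{\sigma_k\},\{\tau_k\}$ and arbitrary $\bm{y}^0,\bm{w}^0\in\mathbb{R}^M$, $\bm{x}^0\in\mathbb{R}^N$, for $k=0,1,2,\dots$ (run indefinitely): Step 1. Approximately solve $\min_{\bm{y}}\ \mathcal{L}_{\sigma_k}(\bm{y},\bm{x}^k)+\frac{\tau_k}{2\sigma_k}\|\bm{y}-\bm{y}^k\|^2$, in the sense that $\bm{y}^{k+1}\in\mathbb{R}^M$ is any point such that, with $$\Delta^{k+1}:=\nabla_y\mathcal{L}_{\sigma_k}(\bm{y}^{k+1},\bm{x}^k)+\tau_k\sigma_k^{-1}(\bm{y}^{k+1}-\bm{y}^k),$$ one has $$2\big|\langle\bm{w}^k-\bm{y}^{k+1},\sigma_k\Delta^{k+1}\rangle\big|+\|\sigma_k\Delta^{k+1}\|^2\le\rho\Big(\big\|\mathtt{prox}_{\sigma_k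 f}(\bm{x}^k+\sigma_kA^\top\bm{y}^{k+1})-\bm{x}^k\big\|^2+\tau_k\|\bm{y}^{k+1}-\bm{y}^k\|^2\Big).$$ Step 2. Set $\bm{x}^{k+1}=\mathtt{prox}_{\sigma_kf}(\bm{x}^k+\sigma_kA^\top\bm{y}^{k+1})$ and $\bm{w}^{k+1}=\bm{w}^k-\sigma_k\Delta^{k+1}$. *)

theory Defs
  imports "HOL-Analysis.Analysis"
begin

section \<open>Convex analysis for extended-real-valued functions\<close>

text \<open>The library's \<open>epigraph\<close> is for real-valued functions only.\<close>

definition epi :: "('a \<Rightarrow> ereal) \<Rightarrow> ('a \<times> real) set" where
  "epi f = {(x, r). f x \<le> ereal r}"

definition proper_closed_convex :: "('a::euclidean_space \<Rightarrow> ereal) \<Rightarrow> bool" where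
  "proper_closed_convex f \<longleftrightarrow>
     (\<forall>x. f x \<noteq> -\<infinity>) \<and> (\<exists>x. f x \<noteq> \<infinity>) \<and> closed (epi f) \<and> convex (epi f)"

definition fenchel_conj :: "('a::euclidean_space \<Rightarrow> ereal) \<Rightarrow> 'a \<Rightarrow> ereal" where
  "fenchel_conj f z = (SUP x. ereal (z \<bullet> x) - f x)"

text \<open>By convention there are no subgradients at points where \<open>f\<close> is infinite. For a proper
  convex function this is automatic; for \<open>\<ell>(\<cdot>, x)\<close>, which is identically \<open>-\<infinity>\<close>
  when \<open>x\<close> is outside the domain of \<open>f\<close>, it is not.\<close>

definition subdifferential :: "('a::euclidean_space \<Rightarrow> ereal) \<Rightarrow> 'a \<Rightarrow> 'a set" where
  "subdifferential f x = {v. \<bar>f x\<bar> \<noteq> \<infinity> \<and> (\<forall>u. f x + ereal (v \<bullet> (u - x)) \<le> f u)}"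

text \<open>For proper closed convex \<open>f\<close> and \<open>\<nu> > 0\<close> the minimizer defining the proximal point
  exists and is unique, so the choice made by \<^const>\<open>arg_min\<close> is immaterial, and the
  infimum defining the Moreau envelope is attained and finite.\<close>

definition prox :: "real \<Rightarrow> ('a::euclidean_space \<Rightarrow> ereal) \<Rightarrow> 'a \<Rightarrow> 'a" where
  "prox \<nu> f x = arg_min (\<lambda>z. f z + ereal (1 / (2 * \<nu>) * (norm (z - x))\<^sup>2)) (\<lambda>_. True)"

definition moreau_env :: "real \<Rightarrow> ('a::euclidean_space \<Rightarrow> ereal) \<Rightarrow> 'a \<Rightarrow> ereal" where
  "moreau_env \<nu> f x = (INF z. f z + ereal (1 / (2 * \<nu>) * (norm (z - x))\<^sup>2))"

definition gradient :: "('a::euclidean_space \<Rightarrow> real) \<Rightarrow> 'a \<Rightarrow> 'a" where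
  "gradient h x = (THE g. GDERIV h x :> g)"

section \<open>The primal-dual framework\<close>

definition G_fun ::
    "(real^'n \<Rightarrow> ereal) \<Rightarrow> real^'n^'m \<Rightarrow> real^'m \<Rightarrow> real^'m \<Rightarrow> real^'n \<Rightarrow> ereal" where
  "G_fun f A b y \<xi> = fenchel_conj f (transpose A *v y + \<xi>) - ereal (b \<bullet> y)"

definition F_fun ::
    "(real^'n \<Rightarrow> ereal) \<Rightarrow> real^'n^'m \<Rightarrow> real^'m \<Rightarrow> real^'m \<Rightarrow> real^'n \<Rightarrow> ereal" where
  "F_fun f A b \<theta> x =
     (INF (y, \<xi>) \<in> UNIV. G_fun f A b y \<xi> - ereal (\<theta> \<bullet> y) - ereal (x \<bullet> \<xi>))"

definition lagrangian ::
    "(real^'n \<Rightarrow> ereal) \<Rightarrow> real^'n^'m \<Rightarrow> real^'m \<Rightarrow> real^'m \<Rightarrow> real^'n \<Rightarrow> ereal" where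
  "lagrangian f A b y x = (INF \<xi>. G_fun f A b y \<xi> - ereal (x \<bullet> \<xi>))"

text \<open>The subgradient map of the convex-concave function \<open>\<ell>\<close>: subgradients in the convex
  variable \<open>y\<close>, and negated supergradients in the concave variable \<open>x\<close>. The explicit form
  is \<open>lagrangian_subdiff_eq\<close> below.\<close>

definition lagrangian_subdiff ::
    "(real^'n \<Rightarrow> ereal) \<Rightarrow> real^'n^'m \<Rightarrow> real^'m \<Rightarrow> real^'m \<Rightarrow> real^'n \<Rightarrow> ((real^'m) \<times> (real^'n)) set" where
  "lagrangian_subdiff f A b y x =
     subdifferential (\<lambda>y'. lagrangian f A b y' x) y \<times>
     subdifferential (\<lambda>x'. - lagrangian f A b y x') x"

definition saddle_points ::
    "(real^'n \<Rightarrow> ereal) \<Rightarrow> real^'n^'m \<Rightarrow> real^'m \<Rightarrow> ((real^'m) \<times> (real^'n)) set" where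
  "saddle_points f A b = {(y, x). (0, 0) \<in> lagrangian_subdiff f A b y x}"

definition aug_lagrangian ::
    "(real^'n \<Rightarrow> ereal) \<Rightarrow> real^'n^'m \<Rightarrow> real^'m \<Rightarrow> real \<Rightarrow> real^'m \<Rightarrow> real^'n \<Rightarrow> real" where
  "aug_lagrangian f A b \<sigma> y x =
     - (b \<bullet> y) + 1 / (2 * \<sigma>) * (norm (x + \<sigma> *\<^sub>R (transpose A *v y)))\<^sup>2
     - 1 / (2 * \<sigma>) * (norm x)\<^sup>2
     - real_of_ereal (moreau_env \<sigma> f (x + \<sigma> *\<^sub>R (transpose A *v y)))"

section \<open>The algorithm\<close>

text \<open>The starting points are unconstrained, and \<open>\<Delta> 0\<close> plays no role.\<close>

definition ripALM ::
    "(real^'n \<Rightarrow> ereal) \<Rightarrow> real^'n^'m \<Rightarrow> real^'m \<Rightarrow> real \<Rightarrow> (nat \<Rightarrow> real) \<Rightarrow> (nat \<Rightarrow> real) \<Rightarrow>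
     (nat \<Rightarrow> real^'m) \<Rightarrow> (nat \<Rightarrow> real^'m) \<Rightarrow> (nat \<Rightarrow> real^'m) \<Rightarrow> (nat \<Rightarrow> real^'n) \<Rightarrow> bool" where
  "ripALM f A b \<rho> \<sigma> \<tau> y \<Delta> w x \<longleftrightarrow>
     (\<forall>k.
        \<Delta> (Suc k) =
          gradient (\<lambda>u. aug_lagrangian f A b (\<sigma> k) u (x k)) (y (Suc k))
          + (\<tau> k / \<sigma> k) *\<^sub>R (y (Suc k) - y k) \<and>
        2 * \<bar>(w k - y (Suc k)) \<bullet> (\<sigma> k *\<^sub>R \<Delta> (Suc k))\<bar> + (norm (\<sigma> k *\<^sub>R \<Delta> (Suc k)))\<^sup>2
          \<le> \<rho> * ((norm (prox (\<sigma> k) f (x k + \<sigma> k *\<^sub>R (transpose A *v y (Suc k))) - x k))\<^sup>2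
                  + \<tau> k * (norm (y (Suc k) - y k))\<^sup>2) \<and>
        x (Suc k) = prox (\<sigma> k) f (x k + \<sigma> k *\<^sub>R (transpose A *v y (Suc k))) \<and>
        w (Suc k) = w k - \<sigma> k *\<^sub>R \<Delta> (Suc k))"

section \<open>The closed forms of the Lagrangian and of its subgradient map\<close>

lemma epi_separation:
  fixes f :: "'a::euclidean_space \<Rightarrow> ereal"
  assumes f: "proper_closed_convex f" and r: "ereal r < f x"
  shows "\<exists>a \<beta> c. \<beta> \<ge> 0 \<and> a \<bullet> x + \<beta> * r < c \<and> (\<forall>u s. f u \<le> ereal s \<longrightarrow> c < a \<bullet> u + \<beta> * s)"
proof -
  have "(x, r) \<notin> epi f" using r by (auto simp: epi_def)
  with f obtain p c where p: "p \<bullet> (x, r) < c" "\<forall>q\<in>epi f. c < p \<bullet> q"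
    using separating_hyperplane_closed_point[of "epi f" "(x, r)"]
    unfolding proper_closed_convex_def by blast
  obtain a \<beta> where ab: "p = (a, \<beta>)" by (cases p)
  have sep: "c < a \<bullet> u + \<beta> * s" if "f u \<le> ereal s" for u s
    using p(2) that by (auto simp: epi_def ab)
  obtain u0 where "f u0 \<noteq> \<infinity>" "f u0 \<noteq> -\<infinity>" using f unfolding proper_closed_convex_def by blast
  then obtain s0 where s0: "f u0 = ereal s0" by (cases "f u0") auto
  have "\<beta> \<ge> 0"
  proof (rule ccontr)
    assume n: "\<not> \<beta> \<ge> 0"
    define s where "s = max s0 ((c - a \<bullet> u0) / \<beta>)"
    have "c < a \<bullet> u0 + \<beta> * s" by (rule sep) (simp add: s0 s_def)
    moreover have "\<beta> * s \<le> \<beta> * ((c - a \<bullet> u0) / \<beta>)"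
      using n by (intro mult_left_mono_neg) (auto simp: s_def)
    ultimately show False using n by simp
  qed
  moreover have "a \<bullet> x + \<beta> * r < c" using p(1) by (simp add: ab)
  ultimately show ?thesis using sep by blast
qed

lemma affine_minorant_nonvertical:
  fixes f :: "'a::euclidean_space \<Rightarrow> ereal"
  assumes f: "proper_closed_convex f" and b: "\<beta> > (0::real)"
    and lt: "a \<bullet> x + \<beta> * r < c" and sep: "\<And>u s. f u \<le> ereal s \<Longrightarrow> c < a \<bullet> u + \<beta> * s"
  shows "\<exists>v d. (\<forall>u. ereal (v \<bullet> u + d) \<le> f u) \<and> r < v \<bullet> x + d"
proof (intro exI conjI allI)
  fix u
  show "ereal ((- (1 / \<beta>) *\<^sub>R a) \<bullet> u + c / \<beta>) \<le> f u"
  proof (cases "f u")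
    case (real s)
    have "c < a \<bullet> u + \<beta> * s" by (rule sep) (simp add: real)
    then show ?thesis using b by (simp add: real field_simps)
  next
    case MInf
    then show ?thesis using f unfolding proper_closed_convex_def by blast
  qed auto
next
  show "r < (- (1 / \<beta>) *\<^sub>R a) \<bullet> x + c / \<beta>" using b lt by (simp add: field_simps)
qed

lemma affine_minorant:
  fixes f :: "'a::euclidean_space \<Rightarrow> ereal"
  assumes f: "proper_closed_convex f" and r: "ereal r < f x"
  shows "\<exists>v d. (\<forall>u. ereal (v \<bullet> u + d) \<le> f u) \<and> r < v \<bullet> x + d"
proof -
  obtain a \<beta> c where s: "\<beta> \<ge> 0" "a \<bullet> x + \<beta> * r < c" "\<And>u s. f u \<le> ereal s \<Longrightarrow> c < a \<bullet> u + \<beta> * s"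
    using epi_separation[OF f r] by auto
  show ?thesis
  proof (cases "\<beta> = 0")
    case False
    then show ?thesis using affine_minorant_nonvertical[OF f _ s(2,3)] s(1) by simp
  next
    case True
    obtain u0 where "f u0 \<noteq> \<infinity>" "f u0 \<noteq> -\<infinity>" using f unfolding proper_closed_convex_def by blast
    then obtain s0 where s0: "f u0 = ereal s0" by (cases "f u0") auto
    have "ereal (s0 - 1) < f u0" by (simp add: s0)
    then obtain a' \<beta>' c' where s': "\<beta>' \<ge> 0" "a' \<bullet> u0 + \<beta>' * (s0 - 1) < c'"
      "\<And>u s. f u \<le> ereal s \<Longrightarrow> c' < a' \<bullet> u + \<beta>' * s"
      using epi_separation[OF f, of "s0 - 1" u0] by auto
    have "c' < a' \<bullet> u0 + \<beta>' * s0" by (rule s'(3)) (simp add: s0)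
    with s'(1,2) have "\<beta>' > 0" by (cases "\<beta>' = 0") auto
    from affine_minorant_nonvertical[OF f this s'(2,3)]
    obtain v d where vd: "\<And>u. ereal (v \<bullet> u + d) \<le> f u" by blast
    define g where "g = c - a \<bullet> x"
    have g: "g > 0" using s(2) True by (simp add: g_def)
    define t where "t = (\<bar>r - (v \<bullet> x + d)\<bar> + 1) / g"
    have t: "t \<ge> 0" using g by (simp add: t_def)
    have tg: "t * g = \<bar>r - (v \<bullet> x + d)\<bar> + 1" using g by (simp add: t_def)
    have "ereal ((v - t *\<^sub>R a) \<bullet> u + (d + t * c)) \<le> f u" for u
    proof (cases "f u")
      case (real q)
      have "c < a \<bullet> u" using s(3)[of u q] by (simp add: real True)
      then have "t * c \<le> t * (a \<bullet> u)" using t by (intro mult_left_mono) auto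
      moreover have "v \<bullet> u + d \<le> q" using vd[of u] by (simp add: real)
      ultimately show ?thesis by (simp add: real inner_diff_left)
    next
      case MInf
      then show ?thesis using f unfolding proper_closed_convex_def by blast
    qed auto
    moreover have "r < (v - t *\<^sub>R a) \<bullet> x + (d + t * c)"
      using tg by (simp add: g_def inner_diff_left right_diff_distrib)
    ultimately show ?thesis by blast
  qed
qed

lemma fenchel_conj_biconj:
  fixes f :: "'a::euclidean_space \<Rightarrow> ereal"
  assumes f: "proper_closed_convex f"
  shows "fenchel_conj (fenchel_conj f) x = f x"
proof (rule antisym)
  show "fenchel_conj (fenchel_conj f) x \<le> f x"
    unfolding fenchel_conj_def[of "fenchel_conj f"]
  proof (rule SUP_least)
    fix z
    have "ereal (z \<bullet> x) - f x \<le> fenchel_conj f z"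
      unfolding fenchel_conj_def by (rule SUP_upper) simp
    moreover have "f x \<noteq> -\<infinity>" using f unfolding proper_closed_convex_def by blast
    ultimately show "ereal (x \<bullet> z) - fenchel_conj f z \<le> f x"
      by (cases "f x"; cases "fenchel_conj f z") (auto simp: inner_commute)
  qed
next
  show "f x \<le> fenchel_conj (fenchel_conj f) x"
  proof (rule dense_le)
    fix e assume e: "e < f x"
    show "e \<le> fenchel_conj (fenchel_conj f) x"
    proof (cases e)
      case (real r)
      obtain v d where vd: "\<And>u. ereal (v \<bullet> u + d) \<le> f u" "r < v \<bullet> x + d"
        using affine_minorant[OF f] e real by blast
      have "fenchel_conj f v \<le> ereal (- d)"
        unfolding fenchel_conj_def
      proof (rule SUP_least)
        fix u show "ereal (v \<bullet> u) - f u \<le> ereal (- d)"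
          using vd(1)[of u] by (cases "f u") auto
      qed
      then have "ereal r \<le> ereal (x \<bullet> v) - fenchel_conj f v"
        using vd(2) by (cases "fenchel_conj f v") (auto simp: inner_commute)
      also have "\<dots> \<le> fenchel_conj (fenchel_conj f) x"
        unfolding fenchel_conj_def[of "fenchel_conj f"] by (rule SUP_upper) simp
      finally show ?thesis by (simp add: real)
    qed (use e in auto)
  qed
qed

lemma lagrangian_eq:
  assumes f: "proper_closed_convex f"
  shows "lagrangian f A b y x = ereal (- (b \<bullet> y) + x \<bullet> (transpose A *v y)) - f x"
proof -
  define c where "c = - (b \<bullet> y) + x \<bullet> (transpose A *v y)"
  define h where "h z = ereal (x \<bullet> z) - fenchel_conj f z" for z
  have r: "range (\<lambda>\<xi>. transpose A *v y + \<xi>) = UNIV"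
    by (rule surj_plus)
  have "lagrangian f A b y x = (INF \<xi>. ereal c - h (transpose A *v y + \<xi>))"
    unfolding lagrangian_def
  proof (rule INF_cong[OF refl])
    fix \<xi>
    show "G_fun f A b y \<xi> - ereal (x \<bullet> \<xi>) = ereal c - h (transpose A *v y + \<xi>)"
      by (cases "fenchel_conj f (transpose A *v y + \<xi>)")
         (auto simp: G_fun_def h_def c_def inner_add_right)
  qed
  also have "\<dots> = (INF z \<in> range (\<lambda>\<xi>. transpose A *v y + \<xi>). ereal c - h z)"
    by (simp only: image_image)
  also have "\<dots> = (INF z. ereal c - h z)"
    by (simp only: r)
  also have "\<dots> = ereal c - (SUP z. h z)"
    by (rule INF_ereal_minus_right) simp_all
  also have "(SUP z. h z) = f x"
    using fenchel_conj_biconj[OF f, of x] by (simp add: h_def fenchel_conj_def[of "fenchel_conj f"])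
  finally show ?thesis by (simp add: c_def)
qed

lemma lagrangian_subdiff_eq:
  assumes f: "proper_closed_convex f"
  shows "lagrangian_subdiff f A b y x =
           {A *v x - b} \<times> {v - transpose A *v y | v. v \<in> subdifferential f x}"
proof (cases "f x")
  case (real s)
  have t: "u \<bullet> (transpose A *v z) = (A *v u) \<bullet> z" for u z
    by (metis dot_lmul_matrix inner_commute vector_transpose_matrix transpose_transpose)
  have 1: "subdifferential (\<lambda>y'. lagrangian f A b y' x) y = {A *v x - b}"
  proof -
    have "g = A *v x - b" if g: "\<And>u. g \<bullet> (u - y) \<le> (A *v x - b) \<bullet> (u - y)" for g
    proof -
      have "(g - (A *v x - b)) \<bullet> (g - (A *v x - b)) \<le> 0"
        using g[of "y + (g - (A *v x - b))"] by (simp add: inner_diff_left)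
      then have "g - (A *v x - b) = 0" by (metis inner_ge_zero inner_eq_zero_iff order_antisym)
      then show ?thesis by (simp only: right_minus_eq)
    qed
    moreover have "g \<in> subdifferential (\<lambda>y'. lagrangian f A b y' x) y \<longleftrightarrow>
        (\<forall>u. g \<bullet> (u - y) \<le> (A *v x - b) \<bullet> (u - y))" for g
      unfolding subdifferential_def lagrangian_eq[OF f] t real
      by (simp add: inner_diff_left inner_diff_right algebra_simps)
    ultimately show ?thesis by blast
  qed
  have 2: "g \<in> subdifferential (\<lambda>x'. - lagrangian f A b y x') x \<longleftrightarrow>
          g + transpose A *v y \<in> subdifferential f x" for g
  proof -
    have "(- lagrangian f A b y x + ereal (g \<bullet> (u - x)) \<le> - lagrangian f A b y u) \<longleftrightarrow>
          (f x + ereal ((g + transpose A *v y) \<bullet> (u - x)) \<le> f u)" for u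
      unfolding lagrangian_eq[OF f] real
      by (cases "f u") (auto simp: inner_add_left inner_diff_right inner_commute algebra_simps)
    then show ?thesis
      unfolding subdifferential_def by (simp add: lagrangian_eq[OF f] real)
  qed
  have "subdifferential (\<lambda>x'. - lagrangian f A b y x') x =
        {v - transpose A *v y | v. v \<in> subdifferential f x}"
  proof (intro set_eqI iffI)
    fix g assume "g \<in> subdifferential (\<lambda>x'. - lagrangian f A b y x') x"
    then have "g + transpose A *v y \<in> subdifferential f x" by (simp only: 2)
    moreover have "g = (g + transpose A *v y) - transpose A *v y" by simp
    ultimately show "g \<in> {v - transpose A *v y | v. v \<in> subdifferential f x}" by blast
  next
    fix g assume "g \<in> {v - transpose A *v y | v. v \<in> subdifferential f x}"
    then obtain v where v: "g = v - transpose A *v y" "v \<in> subdifferential f x" by blast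
    have "g + transpose A *v y \<in> subdifferential f x" using v by simp
    then show "g \<in> subdifferential (\<lambda>x'. - lagrangian f A b y x') x" by (simp only: 2)
  qed
  with 1 show ?thesis unfolding lagrangian_subdiff_def by simp
next
  case PInf
  then show ?thesis
    unfolding lagrangian_subdiff_def subdifferential_def lagrangian_eq[OF f] by simp
next
  case MInf
  then show ?thesis using f unfolding proper_closed_convex_def by blast
qed

end

theory Submission
  imports Defs
begin

text \<open>Fix a saddle point. The proximal step in \<open>x\<close> yields a subgradient of \<open>f\<close> at the new iterate
  (\<open>iterate_subgradient\<close>), so monotonicity of the subdifferential compares the iterate with the saddle
  point. Written out with the three-point identity, this comparison says that an energy, namely the sum
  of the squared distances of \<open>w\<close>, \<open>x\<close> and (weighted by \<open>\<tau>\<close>) \<open>y\<close> to the saddle point, drops at each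
  step by \<open>1 - \<rho>\<close> times the squared step length (\<open>energy_decrease\<close>). The auxiliary sequence \<open>w\<close> is there
  to absorb the inexactness: it moves by exactly minus the error, so the pairing of the error with the
  saddle point telescopes, and the relative error criterion bounds the rest by \<open>\<rho>\<close> times the squared step
  length. The variation of \<open>\<tau>\<close> perturbs the decrease by summable factors only, hence the energy converges
  and the steps tend to zero (\<open>perturbed_decrease_tendsto\<close>). This gives boundedness and makes all
  residuals vanish.

  The function \<open>F\<close> equals \<open>- f\<close> on the shifted constraint set and \<open>-\<infinity>\<close> elsewhere (\<open>F_fun_eq\<close>). At the
  iterates \<open>F\<close> is therefore \<open>- f\<close>, and \<open>G\<close> differs from it by a pairing of bounded sequences with null
  sequences. Subgradient inequalities at the saddle point and at the iterate squeeze \<open>f\<close> to the optimal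
  value, and lower semicontinuity makes cluster points optimal.

  For the convergence of the whole sequence \<open>x\<close>, every primal cluster point together with the fixed
  multiplier is again a saddle point (\<open>saddle_exchange\<close>), so the energy converges with respect to each of
  them. Subtracting the energies of two cluster points leaves only the distances of \<open>x\<close>, which forces the
  two points to agree (\<open>primal_cluster_unique\<close>).

  The link with the definition of the algorithm is the gradient of the augmented Lagrangian. It requires
  existence of proximal points and differentiability of the Moreau envelope; the latter follows from a
  two-sided quadratic estimate (\<open>moreau_env_quadratic_bound\<close>).\<close>

section \<open>Perturbed decrease and cluster points of sequences\<close>

text \<open>Dividing \<open>E k\<close> by the partial product \<open>P k\<close> of the factors \<open>1 + \<nu> i\<close> turns the perturbed
  decrease into a true one: \<open>E k / P k\<close> is decreasing and bounded below, and its decrements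
  dominate \<open>D k / P k\<close>. Summability of \<open>\<nu>\<close> bounds \<open>P\<close>, so both conclusions transfer back.\<close>

lemma perturbed_decrease_tendsto:
  fixes E D \<nu> :: "nat \<Rightarrow> real"
  assumes E: "\<And>k. 0 \<le> E k" and D: "\<And>k. 0 \<le> D k"
    and nu: "\<And>k. 0 \<le> \<nu> k" "summable \<nu>"
    and step: "\<And>k. E (Suc k) \<le> (1 + \<nu> k) * (E k - D k)"
  shows "convergent E" and "D \<longlonglongrightarrow> 0"
proof -
  define P where "P k = (\<Prod>i<k. 1 + \<nu> i)" for k
  have P1: "1 \<le> P k" for k
    unfolding P_def by (intro prod_ge_1) (simp add: nu)
  have PS: "P (Suc k) = (1 + \<nu> k) * P k" for k by (simp add: P_def)
  have PB: "P k \<le> exp (suminf \<nu>)" for k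
  proof -
    have "P k \<le> (\<Prod>i<k. exp (\<nu> i))"
      unfolding P_def by (intro prod_mono) (auto simp: nu)
    also have "\<dots> = exp (\<Sum>i<k. \<nu> i)" by (simp add: exp_sum)
    also have "\<dots> \<le> exp (suminf \<nu>)" using sum_le_suminf[OF nu(2), of "{..<k}"] nu(1) by simp
    finally show ?thesis .
  qed
  have "incseq P"
    by (rule incseq_SucI) (use P1 nu in \<open>simp add: PS distrib_right order_trans[OF zero_le_one]\<close>)
  then obtain p where p: "P \<longlonglongrightarrow> p"
    using PB by (meson incseq_convergent)
  define a where "a k = E k / P k" for k
  have aS: "a (Suc k) \<le> a k - D k / P k" for k
  proof -
    have "a (Suc k) \<le> (1 + \<nu> k) * (E k - D k) / P (Suc k)"
      unfolding a_def using step[of k] P1[of "Suc k"] by (intro divide_right_mono) auto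
    also have "\<dots> = (E k - D k) / P k" using nu(1)[of k] by (simp add: PS)
    finally show ?thesis by (simp add: a_def diff_divide_distrib)
  qed
  have DP: "0 \<le> D k / P k" for k
    using D[of k] P1[of k] by simp
  have dec: "decseq a"
    using aS DP by (intro decseq_SucI) (smt (verit))
  have "0 \<le> a k" for k
    using E[of k] P1[of k] by (simp add: a_def)
  then obtain l where l: "a \<longlonglongrightarrow> l"
    using decseq_convergent[OF dec, of 0] by blast
  have "(\<lambda>k. a k * P k) \<longlonglongrightarrow> l * p" by (intro tendsto_mult l p)
  moreover have "a k * P k = E k" for k using P1[of k] by (simp add: a_def)
  ultimately show "convergent E" by (auto simp: convergent_def)
  have "(\<lambda>k. (a k - a (Suc k)) * P k) \<longlonglongrightarrow> (l - l) * p"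
    by (intro tendsto_mult tendsto_diff l LIMSEQ_Suc p)
  then have z: "(\<lambda>k. (a k - a (Suc k)) * P k) \<longlonglongrightarrow> 0" by simp
  have le: "D k \<le> (a k - a (Suc k)) * P k" for k
    using aS[of k] P1[of k] by (simp add: field_simps)
  show "D \<longlonglongrightarrow> 0"
    by (rule tendsto_sandwich[OF _ _ tendsto_const z]) (auto simp: D le)
qed

lemma bounded_unique_cluster_point_tendsto:
  fixes X :: "nat \<Rightarrow> 'a::heine_borel"
  assumes b: "bounded (range X)"
    and l: "\<And>r z. strict_mono r \<Longrightarrow> (X \<circ> r) \<longlonglongrightarrow> z \<Longrightarrow> z = l"
  shows "X \<longlonglongrightarrow> l"
proof (rule ccontr)
  assume "\<not> X \<longlonglongrightarrow> l"
  then obtain e where e: "e > 0" "\<And>N. \<exists>n\<ge>N. \<not> dist (X n) l < e"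
    unfolding lim_sequentially by blast
  define S where "S = {n. \<not> dist (X n) l < e}"
  have inf: "infinite S" using e(2) by (auto simp: S_def infinite_nat_iff_unbounded_le)
  obtain r :: "nat \<Rightarrow> nat" where r: "strict_mono r" "\<forall>n. r n \<in> S"
    using infinite_enumerate[OF inf] by blast
  have "bounded (range (X \<circ> r))" by (rule bounded_subset[OF b]) auto
  from bounded_imp_convergent_subsequence[OF this]
  obtain z s where s: "strict_mono s" "((X \<circ> r) \<circ> s) \<longlonglongrightarrow> z" by blast
  then have "z = l" using l[of "r \<circ> s" z] r(1) by (simp add: comp_assoc strict_mono_o)
  then have "\<forall>\<^sub>F n in sequentially. dist (X (r (s n))) l < e"
    using s(2) e(1) by (auto simp: tendsto_iff)
  moreover have "\<not> dist (X (r (s n))) l < e" for n using r(2) by (simp add: S_def)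
  ultimately show False by simp
qed

text \<open>The optimality relations hold only from the first iterate on, whereas a subsequence may start at
  index \<open>0\<close>; dropping its first term puts every index into the form \<open>Suc (q j)\<close>.\<close>

lemma cluster_point_Suc:
  fixes X :: "nat \<Rightarrow> 'a::topological_space"
  assumes r: "strict_mono r" and X: "(X \<circ> r) \<longlonglongrightarrow> z"
  obtains q where "filterlim q sequentially sequentially" "(\<lambda>j. X (Suc (q j))) \<longlonglongrightarrow> z"
proof -
  define q where "q j = r (Suc j) - 1" for j
  have le: "Suc j \<le> r (Suc j)" for j by (rule seq_suble[OF r])
  then have S: "Suc (q j) = r (Suc j)" for j unfolding q_def by (metis Suc_diff_1 Suc_le_lessD less_le_trans zero_less_Suc)
  have "j \<le> q j" for j using le[of j] S[of j] by simp
  then have "filterlim q sequentially sequentially"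
    by (intro filterlim_at_top_mono[OF filterlim_ident]) auto
  moreover have "(\<lambda>j. X (Suc (q j))) \<longlonglongrightarrow> z"
    using LIMSEQ_Suc[OF X] by (simp add: S)
  ultimately show ?thesis by (rule that)
qed

lemma tendsto_zero_norm_square_bound:
  fixes X :: "nat \<Rightarrow> 'a::real_normed_vector"
  assumes "\<And>k. (norm (X k))\<^sup>2 \<le> C * D k" and "D \<longlonglongrightarrow> 0"
  shows "X \<longlonglongrightarrow> 0"
proof -
  have "(\<lambda>k. C * D k) \<longlonglongrightarrow> 0" using tendsto_mult_left[OF assms(2), of C] by simp
  then have "(\<lambda>k. (norm (X k))\<^sup>2) \<longlonglongrightarrow> 0"
    by (rule tendsto_sandwich[OF _ _ tendsto_const, rotated 2]) (auto simp: assms(1))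
  then have "(\<lambda>k. sqrt ((norm (X k))\<^sup>2)) \<longlonglongrightarrow> sqrt 0" by (rule tendsto_real_sqrt)
  then show ?thesis by (simp add: tendsto_norm_zero_iff)
qed

lemma inner_bounded_null_tendsto:
  fixes X Y :: "nat \<Rightarrow> 'a::real_inner"
  assumes X: "bounded (range X)" and Y: "Y \<longlonglongrightarrow> 0"
  shows "(\<lambda>k. X k \<bullet> Y k) \<longlonglongrightarrow> 0"
proof -
  obtain B where B: "\<And>k. norm (X k) \<le> B" using X by (auto simp: bounded_iff)
  have le: "norm (X k \<bullet> Y k) \<le> B * norm (Y k)" for k
    using Cauchy_Schwarz_ineq2[of "X k" "Y k"] mult_right_mono[OF B[of k], of "norm (Y k)"] by simp
  have "(\<lambda>k. B * norm (Y k)) \<longlonglongrightarrow> 0"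
    using tendsto_mult_left[OF tendsto_norm_zero[OF Y], of B] by simp
  with always_eventually[OF allI[OF le]] show ?thesis by (rule Lim_null_comparison)
qed

lemma bounded_range_near:
  fixes X :: "nat \<Rightarrow> 'a::real_normed_vector"
  assumes "\<And>k. norm (X k - c) \<le> B"
  shows "bounded (range X)"
  unfolding bounded_def using assms
  by (intro exI[of _ c] exI[of _ B]) (simp add: dist_norm norm_minus_commute)

lemma bounded_range_Suc: "bounded (range X) \<Longrightarrow> bounded (range (\<lambda>k. X (Suc k)))"
  by (rule bounded_subset) auto

text \<open>Turns the monotonicity pairing of the subgradients into differences of squared distances that
  telescope in \<open>k\<close>.\<close>

lemma three_point_identity:
  fixes a p c :: "'a::real_inner"
  shows "2 * ((a - p) \<bullet> (p - c)) = (norm (a - c))\<^sup>2 - (norm (p - c))\<^sup>2 - (norm (p - a))\<^sup>2"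
  by (simp add: power2_norm_eq_inner inner_diff_left inner_diff_right inner_commute)

section \<open>Subgradients, conjugates and epigraphs\<close>

lemma subgradient_finite:
  assumes "v \<in> subdifferential f x"
  obtains s where "f x = ereal s"
  using assms unfolding subdifferential_def by (cases "f x") auto

lemma subgradient_le:
  assumes "v \<in> subdifferential f x" "f x = ereal s" "f u = ereal t"
  shows "s + v \<bullet> (u - x) \<le> t"
  using assms unfolding subdifferential_def
  by (metis (mono_tags, lifting) ereal_less_eq(3) mem_Collect_eq plus_ereal.simps(1))

lemma subgradient_monotone:
  assumes v: "v \<in> subdifferential f x" and w: "w \<in> subdifferential f u"
  shows "0 \<le> (v - w) \<bullet> (x - u)"
proof -
  obtain s where s: "f x = ereal s" using v by (rule subgradient_finite)
  obtain t where t: "f u = ereal t" using w by (rule subgradient_finite)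
  show ?thesis
    using subgradient_le[OF v s t] subgradient_le[OF w t s]
    by (simp add: inner_diff_left inner_diff_right)
qed

lemma fenchel_young:
  assumes "f x = ereal s"
  shows "ereal (v \<bullet> x - s) \<le> fenchel_conj f v"
proof -
  have "ereal (v \<bullet> x) - f x \<le> fenchel_conj f v"
    unfolding fenchel_conj_def by (rule SUP_upper) simp
  then show ?thesis by (simp add: assms)
qed

text \<open>The equality case of the Fenchel--Young inequality.\<close>

lemma fenchel_conj_subgradient:
  assumes v: "v \<in> subdifferential f x" and s: "f x = ereal s"
  shows "fenchel_conj f v = ereal (v \<bullet> x - s)"
proof (rule antisym)
  show "fenchel_conj f v \<le> ereal (v \<bullet> x - s)"
    unfolding fenchel_conj_def
  proof (rule SUP_least)
    fix u
    have "f x + ereal (v \<bullet> (u - x)) \<le> f u"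
      using v by (simp add: subdifferential_def)
    then show "ereal (v \<bullet> u) - f u \<le> ereal (v \<bullet> x - s)"
      using s by (cases "f u") (auto simp: inner_diff_right)
  qed
  have "ereal (v \<bullet> x) - f x \<le> fenchel_conj f v"
    unfolding fenchel_conj_def by (rule SUP_upper) simp
  then show "ereal (v \<bullet> x - s) \<le> fenchel_conj f v" by (simp add: s)
qed

lemma proper_point:
  assumes "proper_closed_convex f"
  obtains z s where "f z = ereal s"
proof -
  obtain z where "f z \<noteq> \<infinity>" "f z \<noteq> -\<infinity>"
    using assms unfolding proper_closed_convex_def by blast
  then show ?thesis using that by (cases "f z") auto
qed

lemma epi_convex_combination:
  assumes f: "proper_closed_convex f" and s: "f x = ereal s" "f u = ereal t"
    and l: "0 \<le> l" "l \<le> 1"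
  shows "f (x + l *\<^sub>R (u - x)) \<le> ereal (s + l * (t - s))"
proof -
  have "convex (epi f)" "(x, s) \<in> epi f" "(u, t) \<in> epi f"
    using f s by (auto simp: proper_closed_convex_def epi_def)
  then have "(1 - l) *\<^sub>R (x, s) + l *\<^sub>R (u, t) \<in> epi f"
    using l by (intro convexD) auto
  moreover have "(1 - l) *\<^sub>R (x, s) + l *\<^sub>R (u, t) = (x + l *\<^sub>R (u - x), s + l * (t - s))"
    by (simp add: algebra_simps)
  ultimately show ?thesis by (simp add: epi_def)
qed

text \<open>Lower semicontinuity, obtained from the closed epigraph.\<close>

lemma epi_lsc_bound:
  assumes f: "proper_closed_convex f"
    and X: "X \<longlonglongrightarrow> z" and S: "S \<longlonglongrightarrow> s" and le: "\<And>k. f (X k) \<le> ereal (S k)"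
  shows "f z \<le> ereal s"
proof -
  have "closed (epi f)" using f by (simp add: proper_closed_convex_def)
  moreover have "(X k, S k) \<in> epi f" for k using le by (simp add: epi_def)
  moreover have "(\<lambda>k. (X k, S k)) \<longlonglongrightarrow> (z, s)" using X S by (rule tendsto_Pair)
  ultimately have "(z, s) \<in> epi f" by (meson closed_sequentially)
  then show ?thesis by (simp add: epi_def)
qed

section \<open>Proximal points\<close>

text \<open>An affine minorant of \<open>f\<close> falls at most linearly, more slowly than the quadratic term grows, so the
  part of the epigraph where the objective does not exceed its value at a fixed point is compact. Minimizing the
  continuous function \<open>\<phi>\<close> over that part replaces an argument with lower semicontinuous functions.\<close>

lemma prox_objective_attains_min:
  fixes f :: "'a::euclidean_space \<Rightarrow> ereal"
  assumes f: "proper_closed_convex f" and q: "0 < (q::real)"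
  shows "\<exists>p. \<forall>z. f p + ereal (q * (norm (p - x))\<^sup>2) \<le> f z + ereal (q * (norm (z - x))\<^sup>2)"
proof -
  obtain z0 s0 where z0: "f z0 = ereal s0" using f by (rule proper_point)
  have "ereal (s0 - 1) < f z0" by (simp add: z0)
  then obtain v d where vd: "\<And>u. ereal (v \<bullet> u + d) \<le> f u"
    using affine_minorant[OF f] by blast
  define \<phi> where "\<phi> = (\<lambda>p::'a \<times> real. snd p + q * (norm (fst p - x))\<^sup>2)"
  define K where "K = {p \<in> epi f. \<phi> p \<le> \<phi> (z0, s0)}"
  \<comment> \<open>Completing the square bounds \<open>- v \<bullet> (z - x)\<close> by half of the quadratic term plus a constant;
    \<open>R\<close> collects what then bounds the other half.\<close>
  define R where "R = \<phi> (z0, s0) - d - v \<bullet> x + (norm v)\<^sup>2 / (2 * q)"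
  have cont: "continuous_on UNIV \<phi>"
    unfolding \<phi>_def by (intro continuous_intros)
  have "closed {p. \<phi> p \<le> \<phi> (z0, s0)}"
    by (rule closed_Collect_le[OF cont continuous_on_const])
  then have "closed K"
    using f closed_Int[of "epi f" "{p. \<phi> p \<le> \<phi> (z0, s0)}"]
    by (simp add: K_def proper_closed_convex_def Int_def)
  moreover have "bounded K"
  proof -
    have bd: "norm (z - x) \<le> sqrt (2 * R / q) \<and> v \<bullet> z + d \<le> r \<and> r \<le> \<phi> (z0, s0)"
      if "(z, r) \<in> K" for z r
    proof -
      have fr: "f z \<le> ereal r" and le: "r + q * (norm (z - x))\<^sup>2 \<le> \<phi> (z0, s0)"
        using that by (auto simp: K_def epi_def \<phi>_def)
      have m: "v \<bullet> z + d \<le> r" using order_trans[OF vd[of z] fr] by simp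
      have "0 \<le> (norm (q *\<^sub>R (z - x) + v))\<^sup>2" by simp
      also have "\<dots> = q\<^sup>2 * (norm (z - x))\<^sup>2 + 2 * q * (v \<bullet> (z - x)) + (norm v)\<^sup>2"
        unfolding power2_norm_eq_inner
        by (simp only: inner_add_left inner_add_right inner_scaleR_left inner_scaleR_right
            inner_commute[of "z - x" v])
           (simp add: power2_eq_square distrib_left)
      finally have "- (v \<bullet> (z - x)) \<le> q / 2 * (norm (z - x))\<^sup>2 + (norm v)\<^sup>2 / (2 * q)"
        using q by (simp add: field_simps power2_eq_square)
      then have "q / 2 * (norm (z - x))\<^sup>2 \<le> R"
        using le m by (simp add: R_def inner_diff_right)
      then have "(norm (z - x))\<^sup>2 \<le> 2 * R / q" using q by (simp add: field_simps)
      then have "norm (z - x) \<le> sqrt (2 * R / q)" by (simp add: real_le_rsqrt)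
      moreover have "r \<le> \<phi> (z0, s0)" using le q by (smt (verit) mult_nonneg_nonneg zero_le_power2)
      ultimately show ?thesis using m by simp
    qed
    define C where "C = sqrt (2 * R / q) + norm x"
    have nz: "norm z \<le> C" if "(z, r) \<in> K" for z r
      using bd[OF that] norm_triangle_sub[of z x] by (simp add: C_def)
    \<comment> \<open>On \<open>K\<close> the affine minorant bounds the epigraph coordinate from below.\<close>
    have "K \<subseteq> cball 0 C \<times> {d - norm v * C .. \<phi> (z0, s0)}"
    proof
      fix p assume p: "p \<in> K"
      obtain z r where zr: "p = (z, r)" by (cases p)
      have "\<bar>v \<bullet> z\<bar> \<le> norm v * C"
        using Cauchy_Schwarz_ineq2[of v z] nz p zr by (meson mult_left_mono norm_ge_zero order_trans)
      then show "p \<in> cball 0 C \<times> {d - norm v * C .. \<phi> (z0, s0)}"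
        using bd[of z r] nz[of z r] p zr by auto
    qed
    then show ?thesis by (rule bounded_subset[rotated]) (intro bounded_Times bounded_cball bounded_closed_interval)
  qed
  ultimately have "compact K" by (simp add: compact_eq_bounded_closed)
  moreover have "(z0, s0) \<in> K" by (simp add: K_def epi_def z0)
  ultimately obtain m where m: "m \<in> K" "\<And>p. p \<in> K \<Longrightarrow> \<phi> m \<le> \<phi> p"
    using continuous_attains_inf[of K \<phi>] continuous_on_subset[OF cont, of K] by blast
  have min: "\<phi> m \<le> \<phi> p" if "p \<in> epi f" for p
    using m that by (cases "p \<in> K") (auto simp: K_def)
  show ?thesis
  proof (intro exI allI)
    fix z
    have "f (fst m) \<le> ereal (snd m)" using m(1) by (auto simp: K_def epi_def)
    then have "f (fst m) + ereal (q * (norm (fst m - x))\<^sup>2) \<le> ereal (\<phi> m)"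
      unfolding \<phi>_def by (cases "f (fst m)") auto
    also have "\<dots> \<le> f z + ereal (q * (norm (z - x))\<^sup>2)"
    proof (cases "f z")
      case (real r)
      then have "(z, r) \<in> epi f" by (simp add: epi_def)
      from min[OF this] show ?thesis by (simp add: real \<phi>_def)
    next
      case MInf
      then show ?thesis using f unfolding proper_closed_convex_def by blast
    qed auto
    finally show "f (fst m) + ereal (q * (norm (fst m - x))\<^sup>2) \<le> f z + ereal (q * (norm (z - x))\<^sup>2)" .
  qed
qed

lemma prox_minimizes:
  fixes f :: "'a::euclidean_space \<Rightarrow> ereal"
  assumes f: "proper_closed_convex f" and nu: "0 < \<nu>"
  shows "f (prox \<nu> f x) + ereal (1 / (2 * \<nu>) * (norm (prox \<nu> f x - x))\<^sup>2)
           \<le> f z + ereal (1 / (2 * \<nu>) * (norm (z - x))\<^sup>2)"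
proof -
  let ?g = "\<lambda>z. f z + ereal (1 / (2 * \<nu>) * (norm (z - x))\<^sup>2)"
  have "\<exists>p. is_arg_min ?g (\<lambda>_. True) p"
    using prox_objective_attains_min[OF f, of "1 / (2 * \<nu>)" x] nu
    by (simp add: is_arg_min_def not_less)
  then have "is_arg_min ?g (\<lambda>_. True) (prox \<nu> f x)"
    unfolding prox_def arg_min_def by (rule someI_ex)
  then show ?thesis by (simp add: is_arg_min_def not_less)
qed

lemma prox_finite:
  fixes f :: "'a::euclidean_space \<Rightarrow> ereal"
  assumes f: "proper_closed_convex f" and nu: "0 < \<nu>"
  obtains s where "f (prox \<nu> f x) = ereal s"
proof -
  obtain z0 s0 where z0: "f z0 = ereal s0" using f by (rule proper_point)
  have "f (prox \<nu> f x) \<noteq> \<infinity>" using prox_minimizes[OF f nu, of x z0] z0 by auto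
  moreover have "f (prox \<nu> f x) \<noteq> -\<infinity>" using f by (auto simp: proper_closed_convex_def)
  ultimately show ?thesis using that by (cases "f (prox \<nu> f x)") auto
qed

text \<open>Comparing the minimizer \<open>p\<close> with the points \<open>p + l (u - p)\<close> of a segment, dividing by \<open>l\<close> and
  letting \<open>l\<close> tend to \<open>0\<close> removes the second-order term and leaves the subgradient inequality.
  Convexity of \<open>f\<close> is what bounds it along the segment.\<close>

lemma prox_subgradient:
  fixes f :: "'a::euclidean_space \<Rightarrow> ereal"
  assumes f: "proper_closed_convex f" and nu: "0 < \<nu>"
  shows "(1 / \<nu>) *\<^sub>R (x - prox \<nu> f x) \<in> subdifferential f (prox \<nu> f x)"
proof -
  define p where "p = prox \<nu> f x"
  define q where "q = 1 / (2 * \<nu>)"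
  obtain s where s: "f p = ereal s" unfolding p_def by (rule prox_finite[OF f nu])
  have ineq: "s + (1 / \<nu>) * ((x - p) \<bullet> (u - p)) \<le> t" if t: "f u = ereal t" for u t
  proof -
    have step: "s \<le> t + 2 * q * ((p - x) \<bullet> (u - p)) + l * (q * (norm (u - p))\<^sup>2)"
      if l: "0 < l" "l \<le> 1" for l
    proof -
      let ?z = "p + l *\<^sub>R (u - p)"
      have "ereal (s + q * (norm (p - x))\<^sup>2) \<le> f ?z + ereal (q * (norm (?z - x))\<^sup>2)"
        using prox_minimizes[OF f nu, of x ?z] by (simp add: p_def[symmetric] s q_def[symmetric])
      also have "\<dots> \<le> ereal (s + l * (t - s)) + ereal (q * (norm (?z - x))\<^sup>2)"
        using epi_convex_combination[OF f s t] l by (intro add_right_mono) auto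
      finally have "q * (norm (p - x))\<^sup>2 \<le> l * (t - s) + q * (norm (?z - x))\<^sup>2" by simp
      also have "(norm (?z - x))\<^sup>2
          = (norm (p - x))\<^sup>2 + l * (2 * ((p - x) \<bullet> (u - p))) + l * l * (norm (u - p))\<^sup>2"
      proof -
        have e: "?z - x = (p - x) + l *\<^sub>R (u - p)" by simp
        show ?thesis unfolding e power2_norm_eq_inner
          by (simp only: inner_add_left inner_add_right inner_scaleR_left inner_scaleR_right
              inner_commute[of "u - p" "p - x"]) (simp add: algebra_simps)
      qed
      finally have "0 \<le> l * (t - s + 2 * q * ((p - x) \<bullet> (u - p)) + l * (q * (norm (u - p))\<^sup>2))"
        by (simp add: algebra_simps)
      then show ?thesis using l by (simp add: zero_le_mult_iff)
    qed
    have "((\<lambda>l. t + 2 * q * ((p - x) \<bullet> (u - p)) + l * (q * (norm (u - p))\<^sup>2))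
        \<longlongrightarrow> t + 2 * q * ((p - x) \<bullet> (u - p)) + 0 * (q * (norm (u - p))\<^sup>2)) (at_right 0)"
      by (intro tendsto_intros)
    moreover have "\<forall>\<^sub>F l in at_right (0::real).
        s \<le> t + 2 * q * ((p - x) \<bullet> (u - p)) + l * (q * (norm (u - p))\<^sup>2)"
      using eventually_at_right_real[of 0 1, simplified]
      by (rule eventually_mono) (auto intro!: step)
    ultimately have "s \<le> t + 2 * q * ((p - x) \<bullet> (u - p)) + 0 * (q * (norm (u - p))\<^sup>2)"
      by (intro tendsto_lowerbound) auto
    then show ?thesis by (simp add: q_def inner_diff_left diff_divide_distrib)
  qed
  have "f p + ereal (((1 / \<nu>) *\<^sub>R (x - p)) \<bullet> (u - p)) \<le> f u" for u
  proof (cases "f u")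
    case (real t)
    then show ?thesis using ineq[OF real] by (simp add: s)
  next
    case MInf
    then show ?thesis using f unfolding proper_closed_convex_def by blast
  qed auto
  then show ?thesis by (simp add: subdifferential_def s p_def[symmetric])
qed

text \<open>Monotonicity of the subdifferential applied to the subgradients of \<open>prox_subgradient\<close>.\<close>

lemma prox_firmly_nonexpansive:
  fixes f :: "'a::euclidean_space \<Rightarrow> ereal"
  assumes f: "proper_closed_convex f" and nu: "0 < \<nu>"
  shows "(norm (prox \<nu> f u - prox \<nu> f v))\<^sup>2 \<le> (u - v) \<bullet> (prox \<nu> f u - prox \<nu> f v)"
proof -
  have "0 \<le> ((1 / \<nu>) *\<^sub>R (u - prox \<nu> f u) - (1 / \<nu>) *\<^sub>R (v - prox \<nu> f v)) \<bullet> (prox \<nu> f u - prox \<nu> f v)"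
    by (rule subgradient_monotone[OF prox_subgradient[OF f nu] prox_subgradient[OF f nu]])
  also have "\<dots> = (1 / \<nu>) * ((u - v) \<bullet> (prox \<nu> f u - prox \<nu> f v) - (norm (prox \<nu> f u - prox \<nu> f v))\<^sup>2)"
    by (simp add: power2_norm_eq_inner inner_diff_left inner_diff_right algebra_simps diff_divide_distrib add_divide_distrib)
  finally show ?thesis using nu by (simp add: zero_le_divide_iff)
qed

text \<open>Add firm nonexpansiveness to \<open>0 \<le> (norm (d - (u - v)))\<^sup>2\<close>, where \<open>d\<close> is the difference of the
  proximal points.\<close>

lemma inner_prox_diff_le:
  fixes f :: "'a::euclidean_space \<Rightarrow> ereal"
  assumes f: "proper_closed_convex f" and nu: "0 < \<nu>"
  shows "(prox \<nu> f u - prox \<nu> f v) \<bullet> (u - v) \<le> (norm (u - v))\<^sup>2"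
proof -
  let ?d = "prox \<nu> f u - prox \<nu> f v"
  have "(norm ?d)\<^sup>2 \<le> ?d \<bullet> (u - v)"
    using prox_firmly_nonexpansive[OF f nu] by (simp add: inner_commute)
  moreover have "0 \<le> (norm (?d - (u - v)))\<^sup>2" by simp
  moreover have "(norm (?d - (u - v)))\<^sup>2 = (norm ?d)\<^sup>2 - 2 * (?d \<bullet> (u - v)) + (norm (u - v))\<^sup>2"
    unfolding power2_norm_eq_inner inner_diff_left[of ?d] inner_diff_right[of _ ?d]
    by (simp add: inner_commute)
  ultimately show ?thesis by linarith
qed

section \<open>Gradients of the Moreau envelope and of the augmented Lagrangian\<close>

lemma moreau_env_eq:
  fixes f :: "'a::euclidean_space \<Rightarrow> ereal"
  assumes f: "proper_closed_convex f" and nu: "0 < \<nu>" and s: "f (prox \<nu> f x) = ereal s"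
  shows "moreau_env \<nu> f x = ereal (s + 1 / (2 * \<nu>) * (norm (prox \<nu> f x - x))\<^sup>2)"
proof -
  have "moreau_env \<nu> f x = f (prox \<nu> f x) + ereal (1 / (2 * \<nu>) * (norm (prox \<nu> f x - x))\<^sup>2)"
    unfolding moreau_env_def
    by (intro antisym INF_lower INF_greatest prox_minimizes[OF f nu]) auto
  then show ?thesis by (simp add: s)
qed

text \<open>The point \<open>prox \<nu> f v\<close> is a competitor in the minimization that defines the envelope at \<open>u\<close>.\<close>

lemma moreau_env_upper:
  fixes f :: "'a::euclidean_space \<Rightarrow> ereal"
  assumes f: "proper_closed_convex f" and nu: "0 < \<nu>"
  shows "real_of_ereal (moreau_env \<nu> f u) - real_of_ereal (moreau_env \<nu> f v)
    \<le> (1 / \<nu>) * ((v - prox \<nu> f v) \<bullet> (u - v)) + 1 / (2 * \<nu>) * (norm (u - v))\<^sup>2"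
proof -
  define p where "p = prox \<nu> f v"
  obtain s where s: "f p = ereal s" unfolding p_def by (rule prox_finite[OF f nu])
  obtain t where t: "f (prox \<nu> f u) = ereal t" by (rule prox_finite[OF f nu])
  have "t + 1 / (2 * \<nu>) * (norm (prox \<nu> f u - u))\<^sup>2 \<le> s + 1 / (2 * \<nu>) * (norm (p - u))\<^sup>2"
    using prox_minimizes[OF f nu, of u p] by (simp add: s t)
  then have "real_of_ereal (moreau_env \<nu> f u) - real_of_ereal (moreau_env \<nu> f v)
      \<le> 1 / (2 * \<nu>) * ((norm (p - u))\<^sup>2 - (norm (p - v))\<^sup>2)"
    using moreau_env_eq[OF f nu t] moreau_env_eq[OF f nu, of v s] s
    by (simp add: p_def[symmetric] diff_divide_distrib)
  also have "(norm (p - u))\<^sup>2 - (norm (p - v))\<^sup>2 = 2 * ((v - p) \<bullet> (u - v)) + (norm (u - v))\<^sup>2"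
    by (simp add: power2_norm_eq_inner inner_diff_left inner_diff_right inner_commute)
  finally show ?thesis using nu by (simp add: p_def add_divide_distrib)
qed

text \<open>The lower estimate is \<open>moreau_env_upper\<close> with \<open>u\<close> and \<open>v\<close> exchanged; the base point of its linear
  part is moved from \<open>u\<close> back to \<open>v\<close> at the price bounded in \<open>inner_prox_diff_le\<close>.\<close>

lemma moreau_env_quadratic_bound:
  fixes f :: "'a::euclidean_space \<Rightarrow> ereal"
  assumes f: "proper_closed_convex f" and nu: "0 < \<nu>"
  shows "\<bar>real_of_ereal (moreau_env \<nu> f u) - real_of_ereal (moreau_env \<nu> f v)
          - (1 / \<nu>) * ((v - prox \<nu> f v) \<bullet> (u - v))\<bar> \<le> 1 / (2 * \<nu>) * (norm (u - v))\<^sup>2"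
proof -
  let ?e = "\<lambda>x. real_of_ereal (moreau_env \<nu> f x)" and ?p = "prox \<nu> f"
  have "?e v - ?e u \<le> (1 / \<nu>) * ((u - ?p u) \<bullet> (v - u)) + 1 / (2 * \<nu>) * (norm (u - v))\<^sup>2"
    using moreau_env_upper[OF f nu, of v u] by (simp add: norm_minus_commute)
  also have "(u - ?p u) \<bullet> (v - u)
      = (?p u - ?p v) \<bullet> (u - v) - (v - ?p v) \<bullet> (u - v) - (norm (u - v))\<^sup>2"
    by (simp add: power2_norm_eq_inner inner_diff_left inner_diff_right)
  also have "(1 / \<nu>) * \<dots> \<le> (1 / \<nu>) * (- ((v - ?p v) \<bullet> (u - v)))"
    using inner_prox_diff_le[OF f nu, of u v] nu by (intro mult_left_mono) auto
  finally have "?e v - ?e u \<le> - ((1 / \<nu>) * ((v - ?p v) \<bullet> (u - v))) + 1 / (2 * \<nu>) * (norm (u - v))\<^sup>2"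
    by simp
  then show ?thesis using moreau_env_upper[OF f nu, of u v] by (simp add: abs_le_iff)
qed

lemma has_derivative_quadratic_bound:
  fixes h :: "'a::real_normed_vector \<Rightarrow> real"
  assumes D: "bounded_linear D"
    and le: "\<And>u. \<bar>h u - h v - D (u - v)\<bar> \<le> C * (norm (u - v))\<^sup>2"
  shows "(h has_derivative D) (at v)"
proof (rule has_derivativeI_sandwich[of 1])
  fix u assume "u \<in> UNIV" "u \<noteq> v" "dist u v < 1"
  then show "norm (h u - h v - D (u - v)) / norm (u - v) \<le> C * norm (u - v)"
    using le[of u] by (simp add: divide_le_eq power2_eq_square mult.assoc)
next
  have "((\<lambda>u. C * norm (u - v)) \<longlongrightarrow> C * norm (v - v)) (at v)"
    by (intro tendsto_intros)
  then show "((\<lambda>u. C * norm (u - v)) \<longlongrightarrow> 0) (at v)" by simp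
qed (auto intro: D)

lemma moreau_env_has_derivative:
  fixes f :: "'a::euclidean_space \<Rightarrow> ereal"
  assumes f: "proper_closed_convex f" and nu: "0 < \<nu>"
  shows "((\<lambda>x. real_of_ereal (moreau_env \<nu> f x)) has_derivative
           (\<lambda>d. (1 / \<nu>) * ((v - prox \<nu> f v) \<bullet> d))) (at v)"
proof (rule has_derivative_quadratic_bound)
  show "bounded_linear (\<lambda>d. (1 / \<nu>) * ((v - prox \<nu> f v) \<bullet> d))"
    by (intro bounded_linear_intros)
qed (rule moreau_env_quadratic_bound[OF f nu])

lemma inner_transpose:
  fixes A :: "real^'n^'m"
  shows "u \<bullet> (transpose A *v z) = (A *v u) \<bullet> z"
  by (metis dot_lmul_matrix vector_transpose_matrix)

text \<open>In the chain rule two contributions of \<open>x + \<sigma> A\<^sup>T y\<close> cancel, one from the squared norm and one from the gradient of the Moreau envelope, and only the proximal point remains.\<close>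

lemma gradient_aug_lagrangian:
  fixes A :: "real^'n^'m"
  assumes f: "proper_closed_convex f" and s: "0 < \<sigma>"
  shows "gradient (\<lambda>u. aug_lagrangian f A b \<sigma> u x) y
           = A *v prox \<sigma> f (x + \<sigma> *\<^sub>R (transpose A *v y)) - b"
proof -
  let ?c = "\<lambda>u. x + \<sigma> *\<^sub>R (transpose A *v u)"
  have c: "(?c has_derivative (\<lambda>d. 0 + \<sigma> *\<^sub>R (transpose A *v d))) (at y)"
    by (intro has_derivative_add has_derivative_const has_derivative_scaleR_right
        bounded_linear_imp_has_derivative matrix_vector_mul_bounded_linear)
  have N: "((\<lambda>u. ?c u \<bullet> ?c u) has_derivative
      (\<lambda>d. ?c y \<bullet> (0 + \<sigma> *\<^sub>R (transpose A *v d)) + (0 + \<sigma> *\<^sub>R (transpose A *v d)) \<bullet> ?c y)) (at y)"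
    by (rule has_derivative_inner[OF c c])
  have M: "((\<lambda>u. real_of_ereal (moreau_env \<sigma> f (?c u))) has_derivative
      (\<lambda>d. (1 / \<sigma>) * ((?c y - prox \<sigma> f (?c y)) \<bullet> (0 + \<sigma> *\<^sub>R (transpose A *v d))))) (at y)"
    by (rule has_derivative_compose[OF c moreau_env_has_derivative[OF f s]])
  have B: "((\<lambda>u. - (b \<bullet> u)) has_derivative (\<lambda>d. - (b \<bullet> d))) (at y)"
    by (intro bounded_linear_imp_has_derivative bounded_linear_minus bounded_linear_inner_right)
  have "((\<lambda>u. aug_lagrangian f A b \<sigma> u x) has_derivative
      (\<lambda>d. - (b \<bullet> d)
          + 1 / (2 * \<sigma>) * (?c y \<bullet> (0 + \<sigma> *\<^sub>R (transpose A *v d)) + (0 + \<sigma> *\<^sub>R (transpose A *v d)) \<bullet> ?c y)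
          - 0
          - (1 / \<sigma>) * ((?c y - prox \<sigma> f (?c y)) \<bullet> (0 + \<sigma> *\<^sub>R (transpose A *v d))))) (at y)"
    unfolding aug_lagrangian_def power2_norm_eq_inner
    by (intro has_derivative_diff has_derivative_add B M has_derivative_const
        has_derivative_mult_right N)
  also have "(\<lambda>d. - (b \<bullet> d)
          + 1 / (2 * \<sigma>) * (?c y \<bullet> (0 + \<sigma> *\<^sub>R (transpose A *v d)) + (0 + \<sigma> *\<^sub>R (transpose A *v d)) \<bullet> ?c y)
          - 0
          - (1 / \<sigma>) * ((?c y - prox \<sigma> f (?c y)) \<bullet> (0 + \<sigma> *\<^sub>R (transpose A *v d))))
      = (\<lambda>d. d \<bullet> (A *v prox \<sigma> f (?c y) - b))"
  proof
    fix d
    have "(transpose A *v d) \<bullet> ?c y = ?c y \<bullet> (transpose A *v d)" by (rule inner_commute)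
    moreover have "prox \<sigma> f (?c y) \<bullet> (transpose A *v d) = d \<bullet> (A *v prox \<sigma> f (?c y))"
      by (simp only: inner_transpose) (rule inner_commute)
    ultimately show "- (b \<bullet> d)
          + 1 / (2 * \<sigma>) * (?c y \<bullet> (0 + \<sigma> *\<^sub>R (transpose A *v d)) + (0 + \<sigma> *\<^sub>R (transpose A *v d)) \<bullet> ?c y)
          - 0
          - (1 / \<sigma>) * ((?c y - prox \<sigma> f (?c y)) \<bullet> (0 + \<sigma> *\<^sub>R (transpose A *v d)))
        = d \<bullet> (A *v prox \<sigma> f (?c y) - b)"
      using s by (simp only: add_0_left inner_scaleR_left inner_scaleR_right inner_diff_left
          inner_diff_right) (simp add: inner_commute[of b d])
  qed
  finally have "((\<lambda>u. aug_lagrangian f A b \<sigma> u x) has_derivative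
      (\<lambda>d. d \<bullet> (A *v prox \<sigma> f (?c y) - b))) (at y)" .
  then have G: "GDERIV (\<lambda>u. aug_lagrangian f A b \<sigma> u x) y :> (A *v prox \<sigma> f (?c y) - b)"
    by (simp add: gderiv_def)
  moreover have "g = g'" if "GDERIV h y :> g" "GDERIV h y :> g'" for h :: "real^'m \<Rightarrow> real" and g g'
  proof -
    have "(\<lambda>d. d \<bullet> g) = (\<lambda>d. d \<bullet> g')"
      using that unfolding gderiv_def by (rule has_derivative_unique)
    then show ?thesis by (simp add: fun_eq_iff vector_eq_ldot)
  qed
  ultimately show ?thesis unfolding gradient_def by (intro the_equality)
qed

section \<open>Saddle points and duality\<close>

text \<open>The joint infimum over \<open>(y, \<xi>)\<close> is taken in two stages, the inner one being the Lagrangian.\<close>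

lemma F_fun_eq_INF_lagrangian:
  "F_fun f A b \<theta> x = (INF y. lagrangian f A b y x - ereal (\<theta> \<bullet> y))"
proof -
  have comm: "g - ereal c - ereal d = g - ereal d - ereal c" for g c d
    by (cases g) auto
  show ?thesis
  proof (rule antisym)
    show "F_fun f A b \<theta> x \<le> (INF y. lagrangian f A b y x - ereal (\<theta> \<bullet> y))"
    proof (rule INF_greatest)
      fix y
      have "F_fun f A b \<theta> x + ereal (\<theta> \<bullet> y) \<le> lagrangian f A b y x"
        unfolding lagrangian_def
      proof (rule INF_greatest)
        fix \<xi>
        have "F_fun f A b \<theta> x \<le> G_fun f A b y \<xi> - ereal (\<theta> \<bullet> y) - ereal (x \<bullet> \<xi>)"
          unfolding F_fun_def by (rule INF_lower2[of "(y, \<xi>)"]) auto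
        then show "F_fun f A b \<theta> x + ereal (\<theta> \<bullet> y) \<le> G_fun f A b y \<xi> - ereal (x \<bullet> \<xi>)"
          by (cases "F_fun f A b \<theta> x"; cases "G_fun f A b y \<xi>") auto
      qed
      then show "F_fun f A b \<theta> x \<le> lagrangian f A b y x - ereal (\<theta> \<bullet> y)"
        by (simp add: ereal_le_minus)
    qed
    show "(INF y. lagrangian f A b y x - ereal (\<theta> \<bullet> y)) \<le> F_fun f A b \<theta> x"
      unfolding F_fun_def
    proof (rule INF_greatest)
      fix p :: "(real, 'b) vec \<times> (real, 'a) vec"
      obtain y \<xi> where p: "p = (y, \<xi>)" by (cases p)
      have "lagrangian f A b y x \<le> G_fun f A b y \<xi> - ereal (x \<bullet> \<xi>)"
        unfolding lagrangian_def by (rule INF_lower) simp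
      then have "lagrangian f A b y x - ereal (\<theta> \<bullet> y) \<le> G_fun f A b y \<xi> - ereal (x \<bullet> \<xi>) - ereal (\<theta> \<bullet> y)"
        by (rule ereal_minus_mono) simp
      then show "(INF y. lagrangian f A b y x - ereal (\<theta> \<bullet> y))
          \<le> (case p of (y, \<xi>) \<Rightarrow> G_fun f A b y \<xi> - ereal (\<theta> \<bullet> y) - ereal (x \<bullet> \<xi>))"
        unfolding p prod.case comm[of _ "\<theta> \<bullet> y"] by (intro INF_lower2[of y]) auto
    qed
  qed
qed

text \<open>The dependence on \<open>y\<close> of the Lagrangian minus \<open>\<theta> \<bullet> y\<close> is linear with slope \<open>A x - b - \<theta>\<close>, so the
  infimum over \<open>y\<close> is \<open>-\<infinity>\<close> unless the slope vanishes.\<close>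

lemma F_fun_eq:
  assumes f: "proper_closed_convex f"
  shows "F_fun f A b \<theta> x = (if A *v x - b = \<theta> then - f x else -\<infinity>)"
proof -
  let ?c = "A *v x - b - \<theta>"
  have fx: "f x \<noteq> -\<infinity>" using f unfolding proper_closed_convex_def by blast
  have t: "lagrangian f A b y x - ereal (\<theta> \<bullet> y) = ereal (?c \<bullet> y) - f x" for y
    unfolding lagrangian_eq[OF f] inner_transpose
    by (cases "f x") (auto simp: inner_diff_left)
  show ?thesis
  proof (cases "A *v x - b = \<theta>")
    case True
    then show ?thesis unfolding F_fun_eq_INF_lagrangian t by (cases "f x") auto
  next
    case False
    then have c: "0 < ?c \<bullet> ?c" by simp
    have "(INF y. ereal (?c \<bullet> y) - f x) \<le> ereal r" for r
    proof (cases "f x")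
      case (real s)
      \<comment> \<open>The multiple of the slope \<open>?c\<close> at which the linear function takes the value \<open>r + s\<close>.\<close>
      have "?c \<bullet> (((r + s) / (?c \<bullet> ?c)) *\<^sub>R ?c) = r + s" using c by simp
      then show ?thesis
        by (intro INF_lower2[of "((r + s) / (?c \<bullet> ?c)) *\<^sub>R ?c"]) (auto simp: real)
    next
      case PInf
      then show ?thesis by simp
    qed (use fx in simp)
    then have "(INF y. ereal (?c \<bullet> y) - f x) = -\<infinity>"
      by (rule ereal_bot)
    then show ?thesis using False unfolding F_fun_eq_INF_lagrangian t by simp
  qed
qed

lemma saddle_point_iff:
  assumes f: "proper_closed_convex f"
  shows "(y, x) \<in> saddle_points f A b \<longleftrightarrow> A *v x = b \<and> transpose A *v y \<in> subdifferential f x"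
  unfolding saddle_points_def using lagrangian_subdiff_eq[OF f, of A b y x] by auto

text \<open>The multiplier \<open>y\<close> of a saddle point bounds how far the objective can fall below its value
  at \<open>x\<close> in terms of the violation of the constraint. This single inequality gives optimality of \<open>x\<close>, the exchange property below and the
  lower estimate for the objective values along the iterates.\<close>

lemma saddle_value_le:
  assumes f: "proper_closed_convex f" and sp: "(y, x) \<in> saddle_points f A b"
    and s: "f x = ereal s" and t: "f z = ereal t"
  shows "s + y \<bullet> (A *v z - b) \<le> t"
proof -
  have "A *v x = b" "transpose A *v y \<in> subdifferential f x"
    using sp by (auto simp: saddle_point_iff[OF f])
  then show ?thesis
    using subgradient_le[of "transpose A *v y" f x s z t] s t
    by (simp add: inner_diff_right dot_lmul_matrix)
qed

text \<open>Saddle points form a product set: any multiplier works for any primal solution. The convergence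
  of the whole sequence \<open>x\<close> rests on this.\<close>

lemma saddle_exchange:
  assumes f: "proper_closed_convex f" and sp: "(y, x) \<in> saddle_points f A b"
    and z: "A *v z = b" "f z \<le> f x"
  shows "(y, z) \<in> saddle_points f A b"
proof -
  have x: "A *v x = b" "transpose A *v y \<in> subdifferential f x"
    using sp by (auto simp: saddle_point_iff[OF f])
  obtain s where s: "f x = ereal s" using x(2) by (rule subgradient_finite)
  have "f z \<noteq> -\<infinity>" using f by (simp add: proper_closed_convex_def)
  then obtain t where t: "f z = ereal t" using z(2) s by (cases "f z") auto
  have "f z + ereal ((transpose A *v y) \<bullet> (u - z)) \<le> f u" for u
  proof (cases "f u")
    case (real q)
    have "s + y \<bullet> (A *v u - b) \<le> q" by (rule saddle_value_le[OF f sp s real])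
    moreover have "t \<le> s" using z(2) s t by simp
    ultimately show ?thesis
      using z(1) by (simp add: real t inner_diff_right dot_lmul_matrix)
  next
    case MInf
    then show ?thesis using f unfolding proper_closed_convex_def by blast
  qed auto
  then have "transpose A *v y \<in> subdifferential f z" by (simp add: subdifferential_def t)
  with z(1) show ?thesis by (simp add: saddle_point_iff[OF f])
qed

lemma weak_duality:
  assumes f: "proper_closed_convex f" and x: "A *v x = b" "f x = ereal s"
  shows "ereal (- s) \<le> G_fun f A b u 0"
proof -
  have "ereal ((transpose A *v u) \<bullet> x - s) \<le> fenchel_conj f (transpose A *v u)"
    by (rule fenchel_young[of f, OF x(2)])
  moreover have "(transpose A *v u) \<bullet> x = b \<bullet> u"
    using x(1) by (simp add: dot_lmul_matrix inner_commute[of u b])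
  ultimately show ?thesis
    unfolding G_fun_def by (cases "fenchel_conj f (transpose A *v u)") auto
qed

lemma G_fun_saddle:
  assumes f: "proper_closed_convex f" and sp: "(y, x) \<in> saddle_points f A b" and s: "f x = ereal s"
  shows "G_fun f A b y 0 = ereal (- s)"
proof -
  have x: "A *v x = b" "transpose A *v y \<in> subdifferential f x"
    using sp by (auto simp: saddle_point_iff[OF f])
  show ?thesis
    using x(1) fenchel_conj_subgradient[OF x(2) s]
    by (simp add: G_fun_def dot_lmul_matrix inner_commute[of b])
qed

lemma F_fun_le_saddle:
  assumes f: "proper_closed_convex f" and sp: "(y, x) \<in> saddle_points f A b" and s: "f x = ereal s"
  shows "F_fun f A b 0 z \<le> ereal (- s)"
proof (cases "A *v z = b \<and> f z \<noteq> \<infinity>")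
  case True
  moreover have "f z \<noteq> -\<infinity>" using f by (simp add: proper_closed_convex_def)
  ultimately obtain t where t: "f z = ereal t" by (cases "f z") auto
  show ?thesis
    using saddle_value_le[OF f sp s t] True by (simp add: F_fun_eq[OF f] t)
qed (auto simp: F_fun_eq[OF f])

lemma saddle_primal_optimal:
  assumes f: "proper_closed_convex f" and sp: "(y, x) \<in> saddle_points f A b"
  shows "is_arg_max (\<lambda>z. F_fun f A b 0 z) (\<lambda>_. True) x" and "is_arg_min f (\<lambda>z. A *v z = b) x"
proof -
  have x: "A *v x = b" "transpose A *v y \<in> subdifferential f x"
    using sp by (auto simp: saddle_point_iff[OF f])
  obtain s where s: "f x = ereal s" using x(2) by (rule subgradient_finite)
  have F: "F_fun f A b 0 x = ereal (- s)" using x(1) by (simp add: F_fun_eq[OF f] s)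
  show "is_arg_max (\<lambda>z. F_fun f A b 0 z) (\<lambda>_. True) x"
    using F_fun_le_saddle[OF f sp s] by (auto simp: is_arg_max_def F not_less)
  have "f x \<le> f z" if "A *v z = b" for z
    using F_fun_le_saddle[OF f sp s, of z] that by (cases "f z") (auto simp: F_fun_eq[OF f] s)
  then show "is_arg_min f (\<lambda>z. A *v z = b) x" using x(1) by (auto simp: is_arg_min_def not_less)
qed

lemma saddle_optimal_values:
  assumes f: "proper_closed_convex f" and sp: "(y, x) \<in> saddle_points f A b" and s: "f x = ereal s"
  shows "(INF u. G_fun f A b u 0) = ereal (- s)" and "(SUP z. F_fun f A b 0 z) = ereal (- s)"
proof -
  have x: "A *v x = b" using sp by (auto simp: saddle_point_iff[OF f])
  show "(INF u. G_fun f A b u 0) = ereal (- s)"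
    using G_fun_saddle[OF f sp s] weak_duality[OF f x s]
    by (intro antisym INF_greatest) (auto intro: INF_lower2[of y])
  have "F_fun f A b 0 x = ereal (- s)" using x by (simp add: F_fun_eq[OF f] s)
  then show "(SUP z. F_fun f A b 0 z) = ereal (- s)"
    using F_fun_le_saddle[OF f sp s]
    by (intro antisym SUP_least) (auto intro: SUP_upper2[of x])
qed

section \<open>Iterates and energy\<close>

text \<open>The fixed saddle point \<open>(yb, xb)\<close> serves as reference point, and \<open>s\<close> is the optimal value of the
  primal problem.\<close>

locale ripALM_run =
  fixes f :: "real^'n \<Rightarrow> ereal"
    and A :: "real^'n^'m"
    and b :: "real^'m"
    and \<rho> \<sigma>min \<tau>min :: real
    and \<sigma> \<tau> \<nu> :: "nat \<Rightarrow> real"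
    and y \<Delta> w :: "nat \<Rightarrow> real^'m"
    and x :: "nat \<Rightarrow> real^'n"
    and yb :: "real^'m" and xb :: "real^'n" and s :: real
  assumes f: "proper_closed_convex f"
    and rho: "0 \<le> \<rho>" "\<rho> < 1"
    and sigma: "0 < \<sigma>min" "\<And>k. \<sigma>min \<le> \<sigma> k"
    and tau: "0 < \<tau>min" "\<And>k. \<tau>min \<le> \<tau> k"
             "\<And>k. \<tau> (Suc k) \<le> (1 + \<nu> k) * \<tau> k"
    and nu: "\<And>k. 0 \<le> \<nu> k" "summable \<nu>"
    and alg: "ripALM f A b \<rho> \<sigma> \<tau> y \<Delta> w x"
    and saddle: "(yb, xb) \<in> saddle_points f A b"
    and f_xb: "f xb = ereal s"
begin

definition step_sq :: "nat \<Rightarrow> real" where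
  "step_sq k = (norm (x (Suc k) - x k))\<^sup>2 + \<tau> k * (norm (y (Suc k) - y k))\<^sup>2"

text \<open>The squared distance of \<open>(w, x, y)\<close> to \<open>(u, z, u)\<close> with \<open>y\<close> weighted by \<open>\<tau> k\<close>; both dual sequences
  are compared with the same point \<open>u\<close>.\<close>

definition energy :: "real^'m \<Rightarrow> real^'n \<Rightarrow> nat \<Rightarrow> real" where
  "energy u z k = (norm (w k - u))\<^sup>2 + (norm (x k - z))\<^sup>2 + \<tau> k * (norm (y k - u))\<^sup>2"

text \<open>The index is that of the step, so \<open>\<theta> k\<close> and \<open>\<xi> k\<close> are \<open>\<theta>\<^sup>k\<^sup>+\<^sup>1\<close> and \<open>\<xi>\<^sup>k\<^sup>+\<^sup>1\<close> of the
  algorithm. By the formula for the gradient, \<open>\<theta>\<close> is the violation of the constraint.\<close>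

definition \<theta> :: "nat \<Rightarrow> real^'m" where
  "\<theta> k = A *v x (Suc k) - b"

definition \<xi> :: "nat \<Rightarrow> real^'n" where
  "\<xi> k = (1 / \<sigma> k) *\<^sub>R (x k - x (Suc k))"

lemma sigma_pos: "0 < \<sigma> k" using sigma(1) sigma(2)[of k] by simp

lemma tau_pos: "0 < \<tau> k" using tau(1) tau(2)[of k] by simp

lemma x_step: "x (Suc k) = prox (\<sigma> k) f (x k + \<sigma> k *\<^sub>R (transpose A *v y (Suc k)))"
  and w_step: "w (Suc k) = w k - \<sigma> k *\<^sub>R \<Delta> (Suc k)"
  using alg unfolding ripALM_def by blast+

lemma error_criterion:
  "2 * \<bar>(w k - y (Suc k)) \<bullet> (\<sigma> k *\<^sub>R \<Delta> (Suc k))\<bar> + (norm (\<sigma> k *\<^sub>R \<Delta> (Suc k)))\<^sup>2 \<le> \<rho> * step_sq k"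
  using alg unfolding ripALM_def step_sq_def x_step[of k] by blast

lemma \<Delta>_step: "\<Delta> (Suc k) = \<theta> k + (\<tau> k / \<sigma> k) *\<^sub>R (y (Suc k) - y k)"
proof -
  have "\<Delta> (Suc k) = gradient (\<lambda>u. aug_lagrangian f A b (\<sigma> k) u (x k)) (y (Suc k))
          + (\<tau> k / \<sigma> k) *\<^sub>R (y (Suc k) - y k)"
    using alg unfolding ripALM_def by blast
  then show ?thesis
    by (simp only: gradient_aug_lagrangian[OF f sigma_pos] x_step[symmetric] \<theta>_def)
qed

text \<open>The proximal step in \<open>x\<close> makes \<open>(y, x)\<close> satisfy the saddle point inclusion up to the residual \<open>\<xi>\<close>.\<close>

lemma iterate_subgradient: "transpose A *v y (Suc k) + \<xi> k \<in> subdifferential f (x (Suc k))"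
proof -
  let ?c = "x k + \<sigma> k *\<^sub>R (transpose A *v y (Suc k))"
  have "(1 / \<sigma> k) *\<^sub>R (?c - x (Suc k)) \<in> subdifferential f (x (Suc k))"
    unfolding x_step[of k] by (rule prox_subgradient[OF f sigma_pos])
  also have "(1 / \<sigma> k) *\<^sub>R (?c - x (Suc k)) = transpose A *v y (Suc k) + \<xi> k"
    using sigma_pos[of k] by (simp add: \<xi>_def algebra_simps)
  finally show ?thesis .
qed

lemma step_sq_nonneg: "0 \<le> step_sq k"
  using tau_pos[of k] by (simp add: step_sq_def)

lemma energy_nonneg: "0 \<le> energy u z k"
  using tau_pos[of k] by (simp add: energy_def)

text \<open>Monotonicity of the subdifferential between the iterate and the saddle point gives a nonnegative
  pairing. Its terms in \<open>x\<close> and in \<open>y\<close> telescope by the three-point identity. The error term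
  \<open>(y (Suc k) - u) \<bullet> e\<close> telescopes along \<open>w\<close>, because \<open>w\<close> moves by exactly \<open>- e\<close>; what is left over
  is the quantity that the relative error criterion bounds by \<open>\<rho> * step_sq k\<close>.\<close>

lemma energy_decrease:
  assumes sp: "(u, z) \<in> saddle_points f A b"
  shows "(norm (w (Suc k) - u))\<^sup>2 + (norm (x (Suc k) - z))\<^sup>2 + \<tau> k * (norm (y (Suc k) - u))\<^sup>2
           \<le> energy u z k - (1 - \<rho>) * step_sq k"
proof -
  define e where "e = \<sigma> k *\<^sub>R \<Delta> (Suc k)"
  have z: "A *v z = b" "transpose A *v u \<in> subdifferential f z"
    using sp by (auto simp: saddle_point_iff[OF f])
  have "0 \<le> (transpose A *v y (Suc k) + \<xi> k - transpose A *v u) \<bullet> (x (Suc k) - z)"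
    by (rule subgradient_monotone[OF iterate_subgradient z(2)])
  also have "\<dots> = (y (Suc k) - u) \<bullet> \<theta> k + \<xi> k \<bullet> (x (Suc k) - z)"
  proof -
    have "(transpose A *v y (Suc k) - transpose A *v u) \<bullet> (x (Suc k) - z) = (y (Suc k) - u) \<bullet> \<theta> k"
      using z(1) by (simp add: inner_diff_left inner_diff_right dot_lmul_matrix \<theta>_def)
    then show ?thesis by (simp add: inner_add_left inner_diff_left)
  qed
  finally have "0 \<le> (2 * \<sigma> k) * ((y (Suc k) - u) \<bullet> \<theta> k + \<xi> k \<bullet> (x (Suc k) - z))"
    using sigma_pos[of k] by simp
  also have "\<dots> = 2 * ((y (Suc k) - u) \<bullet> (\<sigma> k *\<^sub>R \<theta> k)) + 2 * ((\<sigma> k *\<^sub>R \<xi> k) \<bullet> (x (Suc k) - z))"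
    by (simp add: algebra_simps)
  also have "\<sigma> k *\<^sub>R \<xi> k = x k - x (Suc k)"
    using sigma_pos[of k] by (simp add: \<xi>_def)
  also have "\<sigma> k *\<^sub>R \<theta> k = e + \<tau> k *\<^sub>R (y k - y (Suc k))"
    using sigma_pos[of k] by (simp add: e_def \<Delta>_step algebra_simps)
  finally have 1: "0 \<le> 2 * ((y (Suc k) - u) \<bullet> e) + \<tau> k * (2 * ((y k - y (Suc k)) \<bullet> (y (Suc k) - u)))
      + 2 * ((x k - x (Suc k)) \<bullet> (x (Suc k) - z))"
    by (simp add: inner_add_right inner_commute)
  \<comment> \<open>The pairing of the error with \<open>y (Suc k) - u\<close> is replaced by the one with \<open>w k - u\<close>, which telescopes.\<close>
  have "w (Suc k) = w k - e" by (simp add: w_step e_def)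
  then have "(norm (w (Suc k) - u))\<^sup>2 = (norm (w k - u))\<^sup>2 - 2 * ((w k - u) \<bullet> e) + (norm e)\<^sup>2"
    by (simp add: power2_norm_eq_inner inner_diff_left inner_diff_right inner_commute)
  then have 2: "2 * ((y (Suc k) - u) \<bullet> e)
      = (norm (w k - u))\<^sup>2 - (norm (w (Suc k) - u))\<^sup>2 + (norm e)\<^sup>2 - 2 * ((w k - y (Suc k)) \<bullet> e)"
    by (simp add: inner_diff_left)
  have 3: "(norm e)\<^sup>2 - 2 * ((w k - y (Suc k)) \<bullet> e) \<le> \<rho> * step_sq k"
    using error_criterion[of k] unfolding e_def[symmetric] by linarith
  show ?thesis
    using 1 2 3 unfolding three_point_identity energy_def step_sq_def by (simp add: algebra_simps)
qed

text \<open>Replacing \<open>\<tau> k\<close> by \<open>\<tau> (Suc k)\<close> costs the factor \<open>1 + \<nu> k\<close>.\<close>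

lemma energy_step:
  assumes sp: "(u, z) \<in> saddle_points f A b"
  shows "energy u z (Suc k) \<le> (1 + \<nu> k) * (energy u z k - (1 - \<rho>) * step_sq k)"
proof -
  let ?a = "(norm (w (Suc k) - u))\<^sup>2 + (norm (x (Suc k) - z))\<^sup>2"
  have "\<tau> (Suc k) * (norm (y (Suc k) - u))\<^sup>2 \<le> (1 + \<nu> k) * \<tau> k * (norm (y (Suc k) - u))\<^sup>2"
    by (intro mult_right_mono tau) auto
  moreover have "1 * ?a \<le> (1 + \<nu> k) * ?a"
    using nu(1)[of k] by (intro mult_right_mono) auto
  ultimately have "energy u z (Suc k) \<le> (1 + \<nu> k) * (?a + \<tau> k * (norm (y (Suc k) - u))\<^sup>2)"
    unfolding energy_def distrib_left[of "1 + \<nu> k" ?a] by (simp add: mult.assoc)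
  also have "\<dots> \<le> (1 + \<nu> k) * (energy u z k - (1 - \<rho>) * step_sq k)"
    using energy_decrease[OF sp, of k] nu(1)[of k] by (intro mult_left_mono) auto
  finally show ?thesis .
qed

lemma energy_convergent:
  assumes sp: "(u, z) \<in> saddle_points f A b"
  shows "convergent (energy u z)"
  by (rule perturbed_decrease_tendsto(1)[OF energy_nonneg _ nu energy_step[OF sp]])
     (use rho step_sq_nonneg in simp)

lemma step_sq_tendsto: "step_sq \<longlonglongrightarrow> 0"
proof -
  have "(\<lambda>k. (1 - \<rho>) * step_sq k) \<longlonglongrightarrow> 0"
    by (rule perturbed_decrease_tendsto(2)[OF energy_nonneg _ nu energy_step[OF saddle]])
       (use rho step_sq_nonneg in simp)
  then have "(\<lambda>k. 1 / (1 - \<rho>) * ((1 - \<rho>) * step_sq k)) \<longlonglongrightarrow> 1 / (1 - \<rho>) * 0"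
    by (rule tendsto_mult_left)
  then show ?thesis using rho by simp
qed

text \<open>The growth condition on \<open>\<tau>\<close> is itself a perturbed decrease.\<close>

lemma tau_bounded: "\<exists>T\<ge>0. \<forall>k. \<tau> k \<le> T"
proof -
  have "convergent \<tau>"
    by (rule perturbed_decrease_tendsto(1)[where D = "\<lambda>_. 0" and \<nu> = \<nu>])
       (use tau_pos nu tau(3) in \<open>auto intro: less_imp_le\<close>)
  then have "Bseq \<tau>" by (rule convergent_imp_Bseq)
  then obtain T where T: "0 < T" "\<And>k. norm (\<tau> k) \<le> T" unfolding Bseq_def by blast
  have "\<tau> k \<le> T" for k using T(2)[of k] by simp
  then show ?thesis using T(1) by (intro exI[of _ T]) simp
qed

lemma iterates_bounded: "bounded (range y)" "bounded (range w)" "bounded (range x)"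
proof -
  have "Bseq (energy yb xb)" by (rule convergent_imp_Bseq[OF energy_convergent[OF saddle]])
  then obtain C where C: "\<And>k. norm (energy yb xb k) \<le> C" unfolding Bseq_def by blast
  have sum: "(norm (w k - yb))\<^sup>2 + (norm (x k - xb))\<^sup>2 + \<tau> k * (norm (y k - yb))\<^sup>2 \<le> C" for k
    using C[of k] energy_nonneg[of yb xb k] by (simp add: energy_def)
  have "(norm (w k - yb))\<^sup>2 \<le> C \<and> (norm (x k - xb))\<^sup>2 \<le> C \<and> (norm (y k - yb))\<^sup>2 \<le> C / \<tau>min" for k
  proof -
    have "\<tau>min * (norm (y k - yb))\<^sup>2 \<le> \<tau> k * (norm (y k - yb))\<^sup>2"
      by (intro mult_right_mono tau) auto
    moreover have "0 \<le> \<tau>min * (norm (y k - yb))\<^sup>2" using tau(1) by simp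
    ultimately have "(norm (w k - yb))\<^sup>2 \<le> C \<and> (norm (x k - xb))\<^sup>2 \<le> C \<and> \<tau>min * (norm (y k - yb))\<^sup>2 \<le> C"
      using sum[of k] by (smt (verit) zero_le_power2)
    then show ?thesis using tau(1) by (simp add: field_simps)
  qed
  then have n: "norm (w k - yb) \<le> sqrt C" "norm (x k - xb) \<le> sqrt C" "norm (y k - yb) \<le> sqrt (C / \<tau>min)" for k
    by (auto intro: real_le_rsqrt)
  show "bounded (range y)" "bounded (range w)" "bounded (range x)"
    by (rule bounded_range_near, rule n)+
qed

section \<open>Vanishing residuals and convergence of the values\<close>

lemma \<Delta>_tendsto: "(\<lambda>k. \<Delta> (Suc k)) \<longlonglongrightarrow> 0"
proof (rule tendsto_zero_norm_square_bound[OF _ step_sq_tendsto])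
  fix k
  have "\<sigma>min\<^sup>2 * (norm (\<Delta> (Suc k)))\<^sup>2 \<le> (\<sigma> k)\<^sup>2 * (norm (\<Delta> (Suc k)))\<^sup>2"
    using sigma sigma(2)[of k] by (intro mult_right_mono power_mono) auto
  also have "\<dots> = (norm (\<sigma> k *\<^sub>R \<Delta> (Suc k)))\<^sup>2" by (simp add: power_mult_distrib)
  also have "\<dots> \<le> \<rho> * step_sq k" using error_criterion[of k] by linarith
  finally show "(norm (\<Delta> (Suc k)))\<^sup>2 \<le> (\<rho> / \<sigma>min\<^sup>2) * step_sq k"
    using sigma(1) by (simp add: field_simps)
qed

lemma \<xi>_tendsto: "\<xi> \<longlonglongrightarrow> 0"
proof (rule tendsto_zero_norm_square_bound[OF _ step_sq_tendsto])
  fix k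
  have "\<sigma>min\<^sup>2 * (norm (\<xi> k))\<^sup>2 \<le> (\<sigma> k)\<^sup>2 * (norm (\<xi> k))\<^sup>2"
    using sigma sigma(2)[of k] by (intro mult_right_mono power_mono) auto
  also have "\<dots> = (norm (x (Suc k) - x k))\<^sup>2"
    using sigma_pos[of k] by (simp add: \<xi>_def power_divide norm_minus_commute)
  also have "\<dots> \<le> step_sq k" using tau_pos[of k] by (simp add: step_sq_def)
  finally show "(norm (\<xi> k))\<^sup>2 \<le> (1 / \<sigma>min\<^sup>2) * step_sq k"
    using sigma(1) by (simp add: field_simps)
qed

lemma \<theta>_tendsto: "\<theta> \<longlonglongrightarrow> 0"
proof -
  obtain T where T: "0 \<le> T" "\<And>k. \<tau> k \<le> T" using tau_bounded by blast
  have "(\<lambda>k. (\<tau> k / \<sigma> k) *\<^sub>R (y (Suc k) - y k)) \<longlonglongrightarrow> 0"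
  proof (rule tendsto_zero_norm_square_bound[OF _ step_sq_tendsto])
    fix k
    let ?d = "y (Suc k) - y k"
    have "(norm ((\<tau> k / \<sigma> k) *\<^sub>R ?d))\<^sup>2 = \<tau> k * (\<tau> k * (norm ?d)\<^sup>2) / (\<sigma> k)\<^sup>2"
      by (simp add: power_mult_distrib power_divide power2_eq_square)
    also have "\<dots> \<le> T * step_sq k / \<sigma>min\<^sup>2"
      using T tau_pos[of k] sigma sigma(2)[of k]
      by (intro frac_le mult_mono power_mono) (auto simp: step_sq_def step_sq_nonneg)
    finally show "(norm ((\<tau> k / \<sigma> k) *\<^sub>R ?d))\<^sup>2 \<le> (T / \<sigma>min\<^sup>2) * step_sq k" by simp
  qed
  from tendsto_diff[OF \<Delta>_tendsto this] show ?thesis by (simp add: \<Delta>_step)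
qed

definition \<phi> :: "nat \<Rightarrow> real" where
  "\<phi> k = real_of_ereal (f (x (Suc k)))"

lemma f_iterate: "f (x (Suc k)) = ereal (\<phi> k)"
  using iterate_subgradient[of k] by (rule subgradient_finite) (simp add: \<phi>_def)

lemma gap_tendsto: "(\<lambda>k. y (Suc k) \<bullet> \<theta> k + x (Suc k) \<bullet> \<xi> k) \<longlonglongrightarrow> 0"
  using tendsto_add[OF inner_bounded_null_tendsto[OF bounded_range_Suc[OF iterates_bounded(1)] \<theta>_tendsto]
      inner_bounded_null_tendsto[OF bounded_range_Suc[OF iterates_bounded(3)] \<xi>_tendsto]] by simp

text \<open>The right-hand side is the difference of the values of \<open>G\<close> and \<open>F\<close> at the iterate.\<close>

lemma iterate_pairing:
  "(transpose A *v y (Suc k) + \<xi> k) \<bullet> x (Suc k) - b \<bullet> y (Suc k) = y (Suc k) \<bullet> \<theta> k + x (Suc k) \<bullet> \<xi> k"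
proof -
  have "(transpose A *v y (Suc k)) \<bullet> x (Suc k) = y (Suc k) \<bullet> (A *v x (Suc k))"
    by (simp add: dot_lmul_matrix)
  then show ?thesis
    unfolding inner_add_left \<theta>_def inner_diff_right inner_commute[of b] inner_commute[of "\<xi> k"]
    by linarith
qed

text \<open>The subgradient inequality at the saddle point bounds \<open>\<phi>\<close> from below, and the one at the iterate
  bounds it from above; the error terms pair bounded sequences with null sequences.\<close>

lemma \<phi>_tendsto: "\<phi> \<longlonglongrightarrow> s"
proof -
  have lower: "s + yb \<bullet> \<theta> k \<le> \<phi> k" for k
    unfolding \<theta>_def by (rule saddle_value_le[OF f saddle f_xb f_iterate])
  have upper: "\<phi> k \<le> s + (y (Suc k) \<bullet> \<theta> k + x (Suc k) \<bullet> \<xi> k) - xb \<bullet> \<xi> k" for k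
  proof -
    have "A *v xb = b" using saddle by (simp add: saddle_point_iff[OF f])
    then have "(transpose A *v y (Suc k) + \<xi> k) \<bullet> xb = b \<bullet> y (Suc k) + xb \<bullet> \<xi> k"
      by (simp add: inner_add_left dot_lmul_matrix inner_commute[of b "y (Suc k)"]
          inner_commute[of "\<xi> k" xb])
    then show ?thesis
      using subgradient_le[OF iterate_subgradient f_iterate f_xb, of k] iterate_pairing[of k]
      by (simp add: inner_diff_right)
  qed
  have "(\<lambda>k. s + yb \<bullet> \<theta> k) \<longlonglongrightarrow> s + yb \<bullet> 0"
    by (intro tendsto_intros \<theta>_tendsto)
  moreover have "(\<lambda>k. s + (y (Suc k) \<bullet> \<theta> k + x (Suc k) \<bullet> \<xi> k) - xb \<bullet> \<xi> k) \<longlonglongrightarrow> s + 0 - xb \<bullet> 0"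
    by (intro tendsto_add tendsto_diff gap_tendsto tendsto_inner tendsto_const \<xi>_tendsto)
  ultimately show ?thesis
    using lower upper
    by (intro tendsto_sandwich[of "\<lambda>k. s + yb \<bullet> \<theta> k" \<phi> _ "\<lambda>k. s + (y (Suc k) \<bullet> \<theta> k + x (Suc k) \<bullet> \<xi> k) - xb \<bullet> \<xi> k"]) auto
qed

lemma G_iterate: "G_fun f A b (y (Suc k)) (\<xi> k) = ereal (y (Suc k) \<bullet> \<theta> k + x (Suc k) \<bullet> \<xi> k - \<phi> k)"
  unfolding G_fun_def fenchel_conj_subgradient[OF iterate_subgradient f_iterate]
  using iterate_pairing[of k] by simp

lemma G_real_tendsto: "(\<lambda>k. y (Suc k) \<bullet> \<theta> k + x (Suc k) \<bullet> \<xi> k - \<phi> k) \<longlonglongrightarrow> - s"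
  using tendsto_diff[OF gap_tendsto \<phi>_tendsto] by simp

lemma G_tendsto: "(\<lambda>k. G_fun f A b (y (Suc k)) (\<xi> k)) \<longlonglongrightarrow> ereal (- s)"
  unfolding G_iterate by (rule tendsto_ereal[OF G_real_tendsto])

lemma F_tendsto: "(\<lambda>k. F_fun f A b (\<theta> k) (x (Suc k))) \<longlonglongrightarrow> ereal (- s)"
proof -
  have "F_fun f A b (\<theta> k) (x (Suc k)) = ereal (- \<phi> k)" for k
    by (simp add: F_fun_eq[OF f] \<theta>_def f_iterate)
  then show ?thesis using tendsto_ereal[OF tendsto_minus[OF \<phi>_tendsto]] by simp
qed

section \<open>Cluster points of the iterates\<close>

text \<open>The conjugate is a supremum of affine functions. Each of them is continuous and at the iterates lies
  below the value of \<open>G\<close>, so at the cluster point it lies below the limit of these values, and hence so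
  does the supremum.\<close>

lemma dual_cluster_optimal:
  assumes r: "strict_mono r" "(y \<circ> r) \<longlonglongrightarrow> u"
  shows "is_arg_min (\<lambda>u'. G_fun f A b u' 0) (\<lambda>_. True) u"
proof -
  obtain q where q: "filterlim q sequentially sequentially" "(\<lambda>j. y (Suc (q j))) \<longlonglongrightarrow> u"
    by (rule cluster_point_Suc[OF r])
  have bound: "(transpose A *v u) \<bullet> z - t - b \<bullet> u \<le> - s" if t: "f z = ereal t" for z t
  proof (rule LIMSEQ_le)
    show "(\<lambda>j. (transpose A *v y (Suc (q j)) + \<xi> (q j)) \<bullet> z - t - b \<bullet> y (Suc (q j)))
        \<longlonglongrightarrow> (transpose A *v u) \<bullet> z - t - b \<bullet> u"
    proof -
      have "(\<lambda>j. transpose A *v y (Suc (q j))) \<longlonglongrightarrow> transpose A *v u"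
        by (rule bounded_linear.tendsto[OF matrix_vector_mul_bounded_linear q(2)])
      from tendsto_add[OF this filterlim_compose[OF \<xi>_tendsto q(1)]]
      have "(\<lambda>j. transpose A *v y (Suc (q j)) + \<xi> (q j)) \<longlonglongrightarrow> transpose A *v u" by simp
      then show ?thesis by (intro tendsto_intros q(2))
    qed
    show "(\<lambda>j. y (Suc (q j)) \<bullet> \<theta> (q j) + x (Suc (q j)) \<bullet> \<xi> (q j) - \<phi> (q j)) \<longlonglongrightarrow> - s"
      by (rule filterlim_compose[OF G_real_tendsto q(1)])
    show "\<exists>N. \<forall>j\<ge>N. (transpose A *v y (Suc (q j)) + \<xi> (q j)) \<bullet> z - t - b \<bullet> y (Suc (q j))
        \<le> y (Suc (q j)) \<bullet> \<theta> (q j) + x (Suc (q j)) \<bullet> \<xi> (q j) - \<phi> (q j)"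
    proof (intro exI allI impI)
      fix j
      show "(transpose A *v y (Suc (q j)) + \<xi> (q j)) \<bullet> z - t - b \<bullet> y (Suc (q j))
          \<le> y (Suc (q j)) \<bullet> \<theta> (q j) + x (Suc (q j)) \<bullet> \<xi> (q j) - \<phi> (q j)"
        using subgradient_le[OF iterate_subgradient f_iterate t, of "q j"] iterate_pairing[of "q j"]
        by (simp add: inner_diff_right)
    qed
  qed
  have "fenchel_conj f (transpose A *v u) \<le> ereal (b \<bullet> u - s)"
    unfolding fenchel_conj_def
  proof (rule SUP_least)
    fix z
    show "ereal ((transpose A *v u) \<bullet> z) - f z \<le> ereal (b \<bullet> u - s)"
    proof (cases "f z")
      case (real t)
      then show ?thesis using bound[OF real] by simp
    next
      case MInf
      then show ?thesis using f unfolding proper_closed_convex_def by blast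
    qed simp
  qed
  then have le: "G_fun f A b u 0 \<le> ereal (- s)"
    unfolding G_fun_def by (cases "fenchel_conj f (transpose A *v u)") auto
  have ge: "ereal (- s) \<le> G_fun f A b u' 0" for u'
    using saddle by (intro weak_duality[OF f _ f_xb]) (simp add: saddle_point_iff[OF f])
  show ?thesis
    using order_trans[OF le ge] by (auto simp: is_arg_min_def not_less)
qed

lemma primal_cluster_saddle:
  assumes r: "strict_mono r" "(x \<circ> r) \<longlonglongrightarrow> z"
  shows "(yb, z) \<in> saddle_points f A b"
proof -
  obtain q where q: "filterlim q sequentially sequentially" "(\<lambda>j. x (Suc (q j))) \<longlonglongrightarrow> z"
    by (rule cluster_point_Suc[OF r])
  have "(\<lambda>j. A *v x (Suc (q j)) - b) \<longlonglongrightarrow> A *v z - b"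
    by (intro tendsto_diff tendsto_const bounded_linear.tendsto[OF matrix_vector_mul_bounded_linear q(2)])
  moreover have "(\<lambda>j. A *v x (Suc (q j)) - b) \<longlonglongrightarrow> 0"
    using filterlim_compose[OF \<theta>_tendsto q(1)] by (simp add: \<theta>_def)
  ultimately have "A *v z - b = 0" by (rule LIMSEQ_unique)
  moreover have "f z \<le> f xb"
    unfolding f_xb
    by (rule epi_lsc_bound[OF f q(2) filterlim_compose[OF \<phi>_tendsto q(1)]]) (simp add: f_iterate)
  ultimately show ?thesis by (intro saddle_exchange[OF f saddle]) auto
qed

text \<open>Only the \<open>x\<close> part of the energy depends on the primal component of the reference point. Since
  \<open>z\<close> and \<open>z'\<close> are both saddle partners of \<open>yb\<close>, the two energies converge, and so does the
  difference of the squared distances of \<open>x\<close> to \<open>z\<close> and \<open>z'\<close>. Evaluating its limit along the two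
  subsequences gives \<open>- (norm (z - z'))\<^sup>2\<close> and \<open>(norm (z - z'))\<^sup>2\<close>.
  The terms in \<open>w\<close> and \<open>y\<close> cancel
  in this difference, which is essential because \<open>w\<close> and \<open>y\<close> may have different cluster points.\<close>

lemma primal_cluster_unique:
  assumes r: "strict_mono r" "(x \<circ> r) \<longlonglongrightarrow> z" and r': "strict_mono r'" "(x \<circ> r') \<longlonglongrightarrow> z'"
  shows "z = z'"
proof -
  have "convergent (\<lambda>k. energy yb z k - energy yb z' k)"
    by (intro convergent_diff energy_convergent primal_cluster_saddle[OF r] primal_cluster_saddle[OF r'])
  then obtain l where l: "(\<lambda>k. (norm (x k - z))\<^sup>2 - (norm (x k - z'))\<^sup>2) \<longlonglongrightarrow> l"
    by (auto simp: convergent_def energy_def)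
  have along: "l = (norm (v - z))\<^sup>2 - (norm (v - z'))\<^sup>2" if "strict_mono p" "(x \<circ> p) \<longlonglongrightarrow> v" for p v
  proof (rule LIMSEQ_unique)
    show "(\<lambda>j. (norm (x (p j) - z))\<^sup>2 - (norm (x (p j) - z'))\<^sup>2) \<longlonglongrightarrow> l"
      using LIMSEQ_subseq_LIMSEQ[OF l that(1)] by (simp add: o_def)
    show "(\<lambda>j. (norm (x (p j) - z))\<^sup>2 - (norm (x (p j) - z'))\<^sup>2) \<longlonglongrightarrow> (norm (v - z))\<^sup>2 - (norm (v - z'))\<^sup>2"
      using that(2) by (intro tendsto_intros) (simp add: o_def)+
  qed
  have "- (norm (z - z'))\<^sup>2 = (norm (z' - z))\<^sup>2"
    using along[OF r] along[OF r'] by simp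
  then have "(norm (z - z'))\<^sup>2 = 0" by (simp add: norm_minus_commute)
  then show ?thesis by simp
qed

lemma x_tendsto_saddle: "\<exists>z. x \<longlonglongrightarrow> z \<and> (yb, z) \<in> saddle_points f A b"
proof -
  obtain z r where r: "strict_mono r" "(x \<circ> r) \<longlonglongrightarrow> z"
    using bounded_imp_convergent_subsequence[OF iterates_bounded(3)] by blast
  have "x \<longlonglongrightarrow> z"
    by (rule bounded_unique_cluster_point_tendsto[OF iterates_bounded(3)])
       (rule primal_cluster_unique[OF _ _ r])
  with primal_cluster_saddle[OF r] show ?thesis by blast
qed

end

section \<open>Convergence of ripALM\<close>

theorem theorem3p1:
  fixes f :: "real^'n \<Rightarrow> ereal"
    and A :: "real^'n^'m"
    and b :: "real^'m"
    and \<rho> \<sigma>min \<tau>min :: real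
    and \<sigma> \<tau> \<nu> :: "nat \<Rightarrow> real"
    and y \<Delta> w \<theta> :: "nat \<Rightarrow> real^'m"
    and x \<xi> :: "nat \<Rightarrow> real^'n"
  assumes f: "proper_closed_convex f"
    and rho: "0 \<le> \<rho>" "\<rho> < 1"
    and sigma: "0 < \<sigma>min" "\<And>k. \<sigma>min \<le> \<sigma> k"
    and tau: "0 < \<tau>min" "\<And>k. \<tau>min \<le> \<tau> k"
             "\<And>k. \<tau> (Suc k) \<le> (1 + \<nu> k) * \<tau> k"
    and nu: "\<And>k. 0 \<le> \<nu> k" "summable \<nu>"
    and alg: "ripALM f A b \<rho> \<sigma> \<tau> y \<Delta> w x"
    and saddle: "saddle_points f A b \<noteq> {}"
    and theta: "\<And>k. \<theta> (Suc k) = \<Delta> (Suc k) - (\<tau> k / \<sigma> k) *\<^sub>R (y (Suc k) - y k)"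
    and xi: "\<And>k. \<xi> (Suc k) = (1 / \<sigma> k) *\<^sub>R (x k - x (Suc k))"
  shows
    "(bounded (range y) \<and> bounded (range w) \<and> bounded (range x)) \<and>
     ((\<lambda>k. \<Delta> (Suc k)) \<longlonglongrightarrow> 0 \<and> (\<lambda>k. \<theta> (Suc k)) \<longlonglongrightarrow> 0 \<and> (\<lambda>k. \<xi> (Suc k)) \<longlonglongrightarrow> 0) \<and>
     (\<exists>v::real.
        ereal v = (INF u. G_fun f A b u 0) \<and> ereal v = (SUP z. F_fun f A b 0 z) \<and>
        (\<lambda>k. G_fun f A b (y (Suc k)) (\<xi> (Suc k))) \<longlonglongrightarrow> ereal v \<and>
        (\<lambda>k. F_fun f A b (\<theta> (Suc k)) (x (Suc k))) \<longlonglongrightarrow> ereal v) \<and>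
     ((\<forall>u. (\<exists>r. strict_mono r \<and> (y \<circ> r) \<longlonglongrightarrow> u) \<longrightarrow>
          is_arg_min (\<lambda>u'. G_fun f A b u' 0) (\<lambda>_. True) u \<and>
          is_arg_min (\<lambda>u'. fenchel_conj f (transpose A *v u') - ereal (b \<bullet> u')) (\<lambda>_. True) u) \<and>
      (\<forall>z. (\<exists>r. strict_mono r \<and> (x \<circ> r) \<longlonglongrightarrow> z) \<longrightarrow>
          is_arg_max (\<lambda>z'. F_fun f A b 0 z') (\<lambda>_. True) z \<and>
          is_arg_min f (\<lambda>z'. A *v z' = b) z)) \<and>
     (\<exists>z. x \<longlonglongrightarrow> z \<and> is_arg_max (\<lambda>z'. F_fun f A b 0 z') (\<lambda>_. True) z)"
proof -
  obtain yb xb where sp: "(yb, xb) \<in> saddle_points f A b"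
    using saddle by auto
  then have "transpose A *v yb \<in> subdifferential f xb"
    by (simp add: saddle_point_iff[OF f])
  then obtain s where s: "f xb = ereal s" by (rule subgradient_finite)
  interpret run: ripALM_run f A b \<rho> \<sigma>min \<tau>min \<sigma> \<tau> \<nu> y \<Delta> w x yb xb s
    by unfold_locales (fact f rho sigma tau nu alg sp s)+
  have th: "\<theta> (Suc k) = run.\<theta> k" for k by (simp add: theta run.\<Delta>_step)
  have xi': "\<xi> (Suc k) = run.\<xi> k" for k by (simp add: xi run.\<xi>_def)
  have G0: "(\<lambda>u'. fenchel_conj f (transpose A *v u') - ereal (b \<bullet> u')) = (\<lambda>u'. G_fun f A b u' 0)"
    by (simp add: G_fun_def)
  show ?thesis
    unfolding th xi' G0
  proof (intro conjI exI[of _ "- s"] allI impI)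
    show "bounded (range y)" "bounded (range w)" "bounded (range x)"
      by (fact run.iterates_bounded)+
    show "(\<lambda>k. \<Delta> (Suc k)) \<longlonglongrightarrow> 0" "run.\<theta> \<longlonglongrightarrow> 0" "run.\<xi> \<longlonglongrightarrow> 0"
      by (fact run.\<Delta>_tendsto run.\<theta>_tendsto run.\<xi>_tendsto)+
    show "ereal (- s) = (INF u. G_fun f A b u 0)" "ereal (- s) = (SUP z. F_fun f A b 0 z)"
      by (simp_all only: saddle_optimal_values[OF f sp s])
    show "(\<lambda>k. G_fun f A b (y (Suc k)) (run.\<xi> k)) \<longlonglongrightarrow> ereal (- s)"
      "(\<lambda>k. F_fun f A b (run.\<theta> k) (x (Suc k))) \<longlonglongrightarrow> ereal (- s)"
      by (fact run.G_tendsto run.F_tendsto)+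
  next
    fix u assume "\<exists>r. strict_mono r \<and> (y \<circ> r) \<longlonglongrightarrow> u"
    then show "is_arg_min (\<lambda>u'. G_fun f A b u' 0) (\<lambda>_. True) u"
      "is_arg_min (\<lambda>u'. G_fun f A b u' 0) (\<lambda>_. True) u"
      using run.dual_cluster_optimal by blast+
  next
    fix z assume "\<exists>r. strict_mono r \<and> (x \<circ> r) \<longlonglongrightarrow> z"
    then have "(yb, z) \<in> saddle_points f A b" using run.primal_cluster_saddle by blast
    then show "is_arg_max (\<lambda>z'. F_fun f A b 0 z') (\<lambda>_. True) z" "is_arg_min f (\<lambda>z'. A *v z' = b) z"
      by (rule saddle_primal_optimal[OF f])+
  next
    show "\<exists>z. x \<longlonglongrightarrow> z \<and> is_arg_max (\<lambda>z'. F_fun f A b 0 z') (\<lambda>_. True) z"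
      using run.x_tendsto_saddle saddle_primal_optimal(1)[OF f] by blast
  qed
qed

end
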